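(* Let $\mathcal{P}$ be a finite non-Desarguesian projective plane of order $x=u^2$, where $u$ is a positive integer. Let $G$ be a group of automorphisms (collineations) of $\mathcal{P}$ which acts transitively on the points of $\mathcal{P}$, and let $F$ be a nilpotent group which is a normal subgroup of $G$. Then $F$ acts semi-regularly on the points of $\mathcal{P}$.
   Context: An automorphism (collineation) of a projective plane is a permutation of its points that maps lines to lines; an automorphism group of $\mathcal{P}$ is a subgroup of the group of all such automorphisms. A group acts semi-regularly on the points if no non-identity element of it fixes a point. A projective plane of order $x$ has $x^2+x+1$ points and $x+1$ points on each line. *)

theory Defs
  imports "HOL-Algebra.Algebra"
begin

(* Lines are sets of points, incidence is membership. *)
locale projective_plane =
  fixes points :: "'p set" and lines :: "'p set set"
  assumes lines_subset: "l \<in> lines \<Longrightarrow> l \<subseteq> points"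
    and unique_line: "\<lbrakk>p \<in> points; q \<in> points; p \<noteq> q\<rbrakk> \<Longrightarrow> \<exists>!l. l \<in> lines \<and> p \<in> l \<and> q \<in> l"
    and unique_point: "\<lbrakk>l \<in> lines; m \<in> lines; l \<noteq> m\<rbrakk> \<Longrightarrow> \<exists>!p. p \<in> l \<and> p \<in> m"
    and quadrangle: "\<exists>Q \<subseteq> points. card Q = 4 \<and>
      (\<forall>T \<subseteq> Q. card T = 3 \<longrightarrow> (\<forall>l \<in> lines. \<not> T \<subseteq> l))"

locale finite_projective_plane = projective_plane +
  fixes x :: nat
  assumes finite_points: "finite points"
    and card_line: "l \<in> lines \<Longrightarrow> card l = x + 1"

definition collinear :: "'p set set \<Rightarrow> 'p set \<Rightarrow> bool" where
  "collinear lines S \<longleftrightarrow> (\<exists>l \<in> lines. S \<subseteq> l)"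

(* Desargues' theorem holds: two triangles A B C and A' B' C' in perspective from a point Z
   are in perspective from a line.  In a projective plane the hypotheses make A B and A' B'
   distinct lines, and R is their point of intersection; likewise S and T. *)
definition desarguesian :: "'p set set \<Rightarrow> bool" where
  "desarguesian lines \<longleftrightarrow>
    (\<forall>a \<in> lines. \<forall>b \<in> lines. \<forall>c \<in> lines. \<forall>Z A A' B B' C C' R S T.
       a \<noteq> b \<and> b \<noteq> c \<and> a \<noteq> c \<and> Z \<in> a \<inter> b \<inter> c \<and>
       A \<in> a - {Z} \<and> A' \<in> a - {Z} \<and> A \<noteq> A' \<and>
       B \<in> b - {Z} \<and> B' \<in> b - {Z} \<and> B \<noteq> B' \<and>
       C \<in> c - {Z} \<and> C' \<in> c - {Z} \<and> C \<noteq> C' \<and>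
       \<not> collinear lines {A, B, C} \<and> \<not> collinear lines {A', B', C'} \<and>
       collinear lines {A, B, R} \<and> collinear lines {A', B', R} \<and>
       collinear lines {B, C, S} \<and> collinear lines {B', C', S} \<and>
       collinear lines {A, C, T} \<and> collinear lines {A', C', T}
       \<longrightarrow> collinear lines {R, S, T})"

(* As in BijGroup, permutations of the point set are extensional functions. *)
definition collineations :: "'p set \<Rightarrow> 'p set set \<Rightarrow> ('p \<Rightarrow> 'p) set" where
  "collineations points lines = {f \<in> Bij points. \<forall>l \<in> lines. f ` l \<in> lines}"

definition CollineationGroup :: "'p set \<Rightarrow> 'p set set \<Rightarrow> ('p \<Rightarrow> 'p) monoid" where
  "CollineationGroup points lines = BijGroup points \<lparr>carrier := collineations points lines\<rparr>"

lemma (in projective_plane) subgroup_collineations: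
  "subgroup (collineations points lines) (BijGroup points)"
proof (rule group.subgroupI[OF group_BijGroup])
  show "collineations points lines \<subseteq> carrier (BijGroup points)"
    by (auto simp: collineations_def BijGroup_def)
  have "(\<lambda>x\<in>points. x) ` l = l" if "l \<in> lines" for l
    using lines_subset[OF that] by auto
  then have "(\<lambda>x\<in>points. x) \<in> collineations points lines"
    by (simp add: collineations_def id_Bij)
  then show "collineations points lines \<noteq> {}" by blast
next
  fix f g assume f: "f \<in> collineations points lines" and g: "g \<in> collineations points lines"
  have "compose points f g ` l \<in> lines" if "l \<in> lines" for l
  proof -
    have "compose points f g ` l = f ` g ` l"
      using lines_subset[OF that] by (auto simp: compose_def image_image)
    then show ?thesis using f g that by (simp add: collineations_def)
  qed
  then show "f \<otimes>\<^bsub>BijGroup points\<^esub> g \<in> collineations points lines"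
    using f g by (simp add: collineations_def BijGroup_def compose_Bij)
next
  fix f assume f: "f \<in> collineations points lines"
  then have fB: "f \<in> Bij points" by (simp add: collineations_def)
  then have inj: "inj_on f points" and surj: "f ` points = points"
    by (auto simp: Bij_def bij_betw_def)
  let ?g = "\<lambda>x\<in>points. inv_into points f x"
  have g: "inv\<^bsub>BijGroup points\<^esub> f = ?g"
  proof (rule group.inv_equality[OF group_BijGroup])
    show "?g \<otimes>\<^bsub>BijGroup points\<^esub> f = \<one>\<^bsub>BijGroup points\<^esub>"
      using fB by (simp add: BijGroup_def Bij_compose_restrict_eq restrict_inv_into_Bij)
  qed (use fB in \<open>simp_all add: BijGroup_def restrict_inv_into_Bij\<close>)
  have "?g ` l \<in> lines" if l: "l \<in> lines" for l
  proof -
    obtain Q where Q: "Q \<subseteq> points" "card Q = 4"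
      and noncol: "\<And>T m. \<lbrakk>T \<subseteq> Q; card T = 3; m \<in> lines\<rbrakk> \<Longrightarrow> \<not> T \<subseteq> m"
      using quadrangle by metis
    have two: "\<exists>p q. p \<in> l \<and> q \<in> l \<and> p \<noteq> q"
    proof (rule ccontr)
      assume neg: "\<not> ?thesis"
      have finQ: "finite Q" using Q(2) card.infinite by fastforce
      have "\<exists>z. l \<subseteq> {z}" using neg by (cases "l = {}") blast+
      then obtain z where z: "l \<subseteq> {z}" by blast
      have "card (Q - {z}) \<ge> 3" using Q(2) finQ by (simp add: card_Diff_singleton_if)
      then obtain T where T: "T \<subseteq> Q - {z}" "card T = 3" "finite T"
        using obtain_subset_with_card_n by metis
      then obtain a b c where abc: "T = {a, b, c}" "a \<noteq> b" "b \<noteq> c" "a \<noteq> c"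
        by (metis card_3_iff)
      have pts: "a \<in> points" "b \<in> points" "c \<in> points" using abc T Q by auto
      obtain m where m: "m \<in> lines" "a \<in> m" "b \<in> m"
        using unique_line[OF pts(1,2) abc(2)] by blast
      obtain n where n: "n \<in> lines" "b \<in> n" "c \<in> n"
        using unique_line[OF pts(2,3) abc(3)] by blast
      have notc: "c \<notin> m" using noncol[of T m] T m abc by auto
      have "b \<noteq> z" using T abc by auto
      then have bl: "b \<notin> l" using z by blast
      then have "l \<noteq> m" "l \<noteq> n" using m n by auto
      then have "z \<in> m" "z \<in> n"
        using unique_point[OF l m(1)] unique_point[OF l n(1)] z by blast+
      moreover have "m \<noteq> n" using notc n by auto
      ultimately show False
        using unique_point[OF m(1) n(1)] m n \<open>b \<noteq> z\<close> by blast
    qed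
    then obtain p q where pq: "p \<in> l" "q \<in> l" "p \<noteq> q" by blast
    then have pts: "p \<in> points" "q \<in> points" using lines_subset[OF l] by auto
    then obtain p' q' where p': "p' \<in> points" "f p' = p" and q': "q' \<in> points" "f q' = q"
      using surj by (metis imageE)
    then have "p' \<noteq> q'" using pq by auto
    then obtain m where m: "m \<in> lines" "p' \<in> m" "q' \<in> m"
      using unique_line[OF p'(1) q'(1)] by blast
    have "f ` m \<in> lines" using f m by (simp add: collineations_def)
    moreover have "p \<in> f ` m" "q \<in> f ` m" using m p' q' by auto
    ultimately have fm: "f ` m = l" using unique_line[OF pts pq(3)] l pq by blast
    have "?g ` l = inv_into points f ` f ` m"
      using lines_subset[OF l] fm by auto
    also have "\<dots> = m" using inj lines_subset[OF m(1)] by (simp add: inv_into_image_cancel)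
    finally show ?thesis using m by simp
  qed
  then show "inv\<^bsub>BijGroup points\<^esub> f \<in> collineations points lines"
    unfolding g using fB by (simp add: collineations_def restrict_inv_into_Bij)
qed

lemma (in projective_plane) group_CollineationGroup: "group (CollineationGroup points lines)"
  unfolding CollineationGroup_def
  by (rule subgroup.subgroup_is_group[OF subgroup_collineations group_BijGroup])

primrec lower_central_series :: "('a, 'b) monoid_scheme \<Rightarrow> nat \<Rightarrow> 'a set" where
  "lower_central_series G 0 = carrier G"
| "lower_central_series G (Suc n) = generate G
    (\<Union>h \<in> lower_central_series G n. \<Union>g \<in> carrier G.
      {h \<otimes>\<^bsub>G\<^esub> g \<otimes>\<^bsub>G\<^esub> inv\<^bsub>G\<^esub> h \<otimes>\<^bsub>G\<^esub> inv\<^bsub>G\<^esub> g})"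

definition nilpotent :: "('a, 'b) monoid_scheme \<Rightarrow> bool" where
  "nilpotent G \<longleftrightarrow> group G \<and> (\<exists>n. lower_central_series G n = {\<one>\<^bsub>G\<^esub>})"

locale semiregular_action = group_action +
  assumes semiregular: "\<lbrakk>g \<in> carrier G; p \<in> E; \<phi> g p = p\<rbrakk> \<Longrightarrow> g = \<one>"

lemma (in projective_plane) group_action_collineations:
  assumes "subgroup G (CollineationGroup points lines)"
  shows "group_action (CollineationGroup points lines \<lparr>carrier := G\<rparr>) points (\<lambda>g. g)"
proof -
  have "group (CollineationGroup points lines \<lparr>carrier := G\<rparr>)"
    by (rule subgroup.subgroup_is_group[OF assms group_CollineationGroup])
  moreover have "G \<subseteq> Bij points"
    using subgroup.subset[OF assms] by (auto simp: CollineationGroup_def collineations_def)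
  ultimately show ?thesis
    using group_BijGroup[of points]
    by (auto simp: group_action_def group_hom_def group_hom_axioms_def hom_def
        CollineationGroup_def BijGroup_def)
qed

end

theory Submission
  imports Defs
begin

text \<open>
  If a nontrivial element of \<open>F\<close> fixes a point, so does one of prime order \<open>r\<close>; it lies in the
  Sylow \<open>r\<close>-subgroup \<open>N\<close> of \<open>F\<close>, which is normal in \<open>G\<close>. As \<open>G\<close> is also transitive on lines,
  all \<open>N\<close>-orbits of lines have the same size \<open>t\<close>, a power of \<open>r\<close> dividing
  \<open>x\<^sup>2 + x + 1 = (u\<^sup>2 + u + 1) (u\<^sup>2 - u + 1)\<close>. The two factors are coprime, so \<open>t \<le> u\<^sup>2 + u + 1\<close>.
  By double counting, each point \<open>p\<close> lies on exactly \<open>t - 1\<close> ordered pairs of distinct lines in a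
  common \<open>N\<close>-orbit, and each line through \<open>p\<close> moved by the stabilizer of \<open>p\<close> in \<open>N\<close> accounts for
  at least \<open>r - 1\<close> of them.

  For \<open>r \<noteq> 3\<close>, counting fixed points modulo \<open>r\<close> shows that fixed lines have at least three fixed
  points and that the stabilizer moves at least \<open>x / 2\<close> lines through \<open>p\<close>, whence
  \<open>t - 1 \<ge> 2 x = 2 u\<^sup>2\<close>, a contradiction. For \<open>r = 3\<close>, \<open>9\<close> does not divide \<open>x\<^sup>2 + x + 1\<close>, so
  \<open>t = 3\<close> and the stabilizer of a point fixes every line through it; having a second fixed point,
  it has two centres and is trivial.
\<close>

section \<open>Sylow subgroups of nilpotent groups\<close>

text \<open>Conjugation is an automorphism, so it sends a generating commutator to the commutator of
  the conjugates, whose first entry stays in the previous term by induction.\<close>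

lemma (in group) normal_lower_central_series: "lower_central_series G n \<lhd> G"
proof (induction n)
  case 0
  show ?case
    unfolding lower_central_series.simps by (rule normal_invI[OF subgroup_self]) simp
next
  case (Suc n)
  then interpret N: normal "lower_central_series G n" G .
  show ?case
    unfolding lower_central_series.simps
  proof (rule normal_generateI)
    fix k g
    assume k: "k \<in> (\<Union>h \<in> lower_central_series G n. \<Union>g \<in> carrier G.
        {h \<otimes> g \<otimes> inv h \<otimes> inv g})" and g: "g \<in> carrier G"
    then obtain h y where h: "h \<in> lower_central_series G n" and y: "y \<in> carrier G"
      and k: "k = h \<otimes> y \<otimes> inv h \<otimes> inv y" by auto
    have hc: "h \<in> carrier G" using h by (rule N.mem_carrier)
    let ?h = "g \<otimes> h \<otimes> inv g" and ?y = "g \<otimes> y \<otimes> inv g"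
    have "g \<otimes> k \<otimes> inv g = ?h \<otimes> ?y \<otimes> inv ?h \<otimes> inv ?y"
      using g hc y by (simp add: k m_assoc inv_mult_group) (simp flip: m_assoc)
    moreover have "?h \<in> lower_central_series G n" by (rule N.inv_op_closed2[OF g h])
    ultimately show "g \<otimes> k \<otimes> inv g \<in> (\<Union>h \<in> lower_central_series G n. \<Union>g \<in> carrier G.
        {h \<otimes> g \<otimes> inv h \<otimes> inv g})" using g y by auto
  qed auto
qed

lemma (in group) conj_nat_pow:
  assumes "g \<in> carrier G" "h \<in> carrier G"
  shows "(g \<otimes> h \<otimes> inv g) [^] (k::nat) = g \<otimes> h [^] k \<otimes> inv g"
  using assms
proof (induction k)
  case (Suc k)
  then show ?case by (simp add: m_assoc) (simp flip: m_assoc)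
qed simp

text \<open>For \<open>z = a b a\<^sup>-\<^sup>1 b\<^sup>-\<^sup>1\<close> central, both \<open>z b\<close> and \<open>b\<close> have \<open>n\<close>-th power \<open>1\<close>, so
  \<open>z\<close> does too; symmetrically its \<open>m\<close>-th power is \<open>1\<close>.\<close>
lemma (in group) central_commutator_coprime:
  assumes ab: "a \<in> carrier G" "b \<in> carrier G"
    and pow: "a [^] (m::nat) = \<one>" "b [^] (n::nat) = \<one>" and cop: "coprime m n"
    and central: "\<And>g. g \<in> carrier G \<Longrightarrow>
      (a \<otimes> b \<otimes> inv a \<otimes> inv b) \<otimes> g = g \<otimes> (a \<otimes> b \<otimes> inv a \<otimes> inv b)"
  shows "a \<otimes> b \<otimes> inv a \<otimes> inv b = \<one>"
proof -
  define z where "z = a \<otimes> b \<otimes> inv a \<otimes> inv b"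
  have z: "z \<in> carrier G" using ab by (simp add: z_def)
  have "z \<otimes> b = a \<otimes> b \<otimes> inv a" using ab by (simp add: z_def m_assoc)
  then have "z [^] n \<otimes> b [^] n = a \<otimes> b [^] n \<otimes> inv a"
    using pow_mult_distrib[of z b n] central[of b] conj_nat_pow[of a b n] ab z
    by (simp flip: z_def)
  then have zn: "z [^] n = \<one>" using pow ab z by simp
  \<comment> \<open>\<open>inv z\<close> is the commutator of \<open>b\<close> and \<open>a\<close>,
    so the argument repeats with the roles exchanged.\<close>
  have "inv z \<otimes> a = b \<otimes> a \<otimes> inv b"
    using ab by (simp add: z_def m_assoc inv_mult_group)
  moreover have "inv z \<otimes> a = a \<otimes> inv z"
    using central[of a] ab z by (metis z_def inv_comm inv_closed inv_solve_left inv_solve_right m_assoc m_closed)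
  ultimately have "inv z [^] m \<otimes> a [^] m = b \<otimes> a [^] m \<otimes> inv b"
    using pow_mult_distrib[of "inv z" a m] conj_nat_pow[of b a m] ab z by simp
  then have "inv z [^] m = \<one>" using pow ab z by simp
  then have zm: "z [^] m = \<one>" using z by (simp add: nat_pow_inv)
  have "ord z dvd gcd m n" using zm zn z by (simp add: pow_eq_id)
  then have "ord z = 1" using cop by simp
  then have "z = \<one>" using z ord_eq_1[of z] by simp
  then show ?thesis by (simp add: z_def)
qed

text \<open>The commutator of \<open>a\<close> and \<open>b\<close> descends through the whole lower
  central series: if it lies in one term, it is central modulo the next, hence trivial there by
  \<open>central_commutator_coprime\<close>. Some term is trivial.\<close>

lemma (in group) nilpotent_coprime_commute:
  assumes nil: "nilpotent G" and ab: "a \<in> carrier G" "b \<in> carrier G"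
    and pow: "a [^] (m::nat) = \<one>" "b [^] (n::nat) = \<one>" and cop: "coprime m n"
  shows "a \<otimes> b = b \<otimes> a"
proof -
  let ?z = "a \<otimes> b \<otimes> inv a \<otimes> inv b"
  have "?z \<in> lower_central_series G i" for i
  proof (induction i)
    case 0
    then show ?case using ab by simp
  next
    case (Suc i)
    define K where "K = lower_central_series G (Suc i)"
    interpret K: normal K G unfolding K_def by (rule normal_lower_central_series)
    have hom: "group_hom G (G Mod K) (\<lambda>a. K #> a)"
      using K.r_coset_hom_Mod K.factorgroup_is_group
      by (simp add: group_hom_def group_hom_axioms_def is_group)
    interpret Q: group_hom G "G Mod K" "\<lambda>a. K #> a" by (rule hom)
    have comm: "(K #> ?z) \<otimes>\<^bsub>G Mod K\<^esub> (K #> g) = (K #> g) \<otimes>\<^bsub>G Mod K\<^esub> (K #> ?z)"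
      if g: "g \<in> carrier G" for g
    proof -
      have "?z \<otimes> g \<otimes> inv ?z \<otimes> inv g \<in> K"
        unfolding K_def lower_central_series.simps
        by (rule generate.incl) (use Suc g in blast)
      moreover have "?z \<otimes> g = (?z \<otimes> g \<otimes> inv ?z \<otimes> inv g) \<otimes> (g \<otimes> ?z)"
        using g ab by (simp add: m_assoc inv_mult_group) (simp flip: m_assoc)
      ultimately have "?z \<otimes> g \<in> K #> (g \<otimes> ?z)" unfolding r_coset_def by blast
      then have "K #> (g \<otimes> ?z) = K #> (?z \<otimes> g)"
        by (rule repr_independence) (use g ab K.subgroup_axioms in auto)
      then show ?thesis using g ab by simp
    qed
    let ?a = "K #> a" and ?b = "K #> b"
    have img: "K #> ?z = ?a \<otimes>\<^bsub>G Mod K\<^esub> ?b \<otimes>\<^bsub>G Mod K\<^esub> inv\<^bsub>G Mod K\<^esub> ?a \<otimes>\<^bsub>G Mod K\<^esub> inv\<^bsub>G Mod K\<^esub> ?b"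
      using ab by simp
    have "?a \<otimes>\<^bsub>G Mod K\<^esub> ?b \<otimes>\<^bsub>G Mod K\<^esub> inv\<^bsub>G Mod K\<^esub> ?a \<otimes>\<^bsub>G Mod K\<^esub> inv\<^bsub>G Mod K\<^esub> ?b = \<one>\<^bsub>G Mod K\<^esub>"
    proof (rule Q.H.central_commutator_coprime[OF _ _ _ _ cop])
      show "?a [^]\<^bsub>G Mod K\<^esub> m = \<one>\<^bsub>G Mod K\<^esub>" "?b [^]\<^bsub>G Mod K\<^esub> n = \<one>\<^bsub>G Mod K\<^esub>"
        using ab pow by (simp_all flip: Q.hom_nat_pow)
    next
      fix c assume "c \<in> carrier (G Mod K)"
      then obtain g where "g \<in> carrier G" "c = K #> g" by (auto simp: FactGroup_def RCOSETS_def)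
      then show "?a \<otimes>\<^bsub>G Mod K\<^esub> ?b \<otimes>\<^bsub>G Mod K\<^esub> inv\<^bsub>G Mod K\<^esub> ?a \<otimes>\<^bsub>G Mod K\<^esub> inv\<^bsub>G Mod K\<^esub> ?b \<otimes>\<^bsub>G Mod K\<^esub> c =
          c \<otimes>\<^bsub>G Mod K\<^esub> (?a \<otimes>\<^bsub>G Mod K\<^esub> ?b \<otimes>\<^bsub>G Mod K\<^esub> inv\<^bsub>G Mod K\<^esub> ?a \<otimes>\<^bsub>G Mod K\<^esub> inv\<^bsub>G Mod K\<^esub> ?b)"
        using comm[of g] unfolding img by simp
    qed (use ab in simp_all)
    then have "K #> ?z = K" using img by simp
    then have "?z \<in> K" by (rule coset_join1) (use ab K.subgroup_axioms in simp_all)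
    then show ?case unfolding K_def .
  qed
  then have "?z = \<one>" using nil unfolding nilpotent_def by auto
  then show ?thesis using ab
    by (metis inv_closed inv_equality inv_inv m_closed inv_mult_group m_assoc r_one r_inv)
qed

text \<open>Inverses are powers in a finite group. This spares a direct proof that the normalizer
  below is closed under inverses.\<close>

lemma (in group) finite_submonoid_subgroup:
  assumes "finite (carrier G)" and M: "submonoid M G"
  shows "subgroup M G"
proof (rule subgroupI)
  show "M \<subseteq> carrier G" "M \<noteq> {}" using submonoid.subset[OF M] submonoid.one_closed[OF M] by auto
  fix g assume g: "g \<in> M"
  then have gc: "g \<in> carrier G" using submonoid.subset[OF M] by auto
  have pow: "g [^] k \<in> M" for k :: nat
    by (induction k) (simp_all add: g submonoid.one_closed[OF M] submonoid.m_closed[OF M])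
  have "ord g \<ge> 1" using assms(1) gc by (rule ord_ge_1)
  then have "g [^] (ord g - 1) \<otimes> g = \<one>"
    using gc by (metis Suc_pred' One_nat_def Suc_le_lessD nat_pow_Suc pow_ord_eq_1)
  then have "inv g = g [^] (ord g - 1)" using gc by (simp add: inv_equality)
  then show "inv g \<in> M" using pow by simp
qed (rule submonoid.m_closed[OF M])

text \<open>The normalizer of a Sylow \<open>p\<close>-subgroup contains a Sylow \<open>q\<close>-subgroup for every prime \<open>q\<close>,
  hence is the whole group.\<close>
lemma (in group) nilpotent_primary_subgroup:
  assumes nil: "nilpotent G" and fin: "finite (carrier G)" and p: "Factorial_Ring.prime (p::nat)"
  shows "\<exists>P k. subgroup P G \<and> card P = p ^ k \<and>
    (\<forall>a \<in> carrier G. a \<in> P \<longleftrightarrow> (\<exists>j. a [^] (p ^ j) = \<one>))"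
proof -
  have o: "order G \<noteq> 0" using fin by (simp add: order_gt_0_iff_finite)
  have sylow: "\<exists>Q. subgroup Q G \<and> card Q = q ^ multiplicity q (order G)" if "Factorial_Ring.prime q" for q
    using sylow_thm[OF that is_group, of "multiplicity q (order G)" "order G div q ^ multiplicity q (order G)"]
      fin by (simp add: multiplicity_dvd)
  define k where "k = multiplicity p (order G)"
  obtain P where P: "subgroup P G" "card P = p ^ k" using sylow[OF p] k_def by blast
  interpret P: subgroup P G by (rule P)
  have tors: "a [^] card Q = \<one>" if "subgroup Q G" "a \<in> Q" for a Q
    using group.pow_order_eq_1[OF subgroup_imp_group[OF that(1)], of a] that(2)
    by (simp add: order_def flip: nat_pow_consistent)
  \<comment> \<open>The normalizer of \<open>P\<close>, defined by one inclusion only; finiteness of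
    the group makes this enough.\<close>
  define M where "M = {g \<in> carrier G. \<forall>h\<in>P. g \<otimes> h \<otimes> inv g \<in> P}"
  have "submonoid M G"
  proof
    fix g h assume g: "g \<in> M" and h: "h \<in> M"
    have "g \<otimes> h \<otimes> y \<otimes> inv (g \<otimes> h) \<in> P" if y: "y \<in> P" for y
    proof -
      have "g \<otimes> (h \<otimes> y \<otimes> inv h) \<otimes> inv g \<in> P" using g h y by (auto simp: M_def)
      then show ?thesis using g h y by (simp add: M_def m_assoc inv_mult_group)
    qed
    then show "g \<otimes> h \<in> M" using g h by (simp add: M_def)
  qed (auto simp: M_def)
  then have M: "subgroup M G" by (rule finite_submonoid_subgroup[OF fin])
  have "multiplicity q (order G) \<le> multiplicity q (card M)" if q: "Factorial_Ring.prime q" for q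
  proof -
    have "\<exists>Q. subgroup Q G \<and> card Q = q ^ multiplicity q (order G) \<and> Q \<subseteq> M"
    proof (cases "q = p")
      case True
      have "P \<subseteq> M" by (auto simp: M_def)
      then show ?thesis using P True k_def by blast
    next
      case False
      obtain Q where Q: "subgroup Q G" "card Q = q ^ multiplicity q (order G)"
        using sylow[OF q] by blast
      \<comment> \<open>Elements of \<open>Q\<close> and \<open>P\<close> have coprime exponents, so
        nilpotency makes them commute.\<close>
      have "g \<in> M" if g: "g \<in> Q" for g
      proof -
        have gc: "g \<in> carrier G" using g Q by (simp add: subgroup.mem_carrier)
        have cop: "coprime (card Q) (card P)"
          using False p q by (simp add: Q P primes_coprime)
        have "g \<otimes> h = h \<otimes> g" if h: "h \<in> P" for h
          using nilpotent_coprime_commute[OF nil gc P.mem_carrier[OF h]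
              tors[OF Q(1) g] tors[OF P(1) h] cop] .
        then show ?thesis using gc by (simp add: M_def m_assoc)
      qed
      then show ?thesis using Q by blast
    qed
    then obtain Q where Q: "subgroup Q G" "card Q = q ^ multiplicity q (order G)" "Q \<subseteq> M" by blast
    have "card Q dvd card M"
      using group.lagrange[OF subgroup_imp_group[OF M] subgroup_incl[OF Q(1) M Q(3)]]
      by (simp add: order_def) (metis dvd_triv_right)
    then show ?thesis
      using Q q subgroup.finite_imp_card_positive[OF M fin] by (intro multiplicity_geI) auto
  qed
  then have "order G dvd card M"
    using subgroup.finite_imp_card_positive[OF M fin] o by (intro multiplicity_le_imp_dvd) auto
  then have "card (carrier G) \<le> card M"
    using subgroup.finite_imp_card_positive[OF M fin] by (simp add: order_def dvd_imp_le)
  then have "M = carrier G" using fin by (intro card_seteq) (auto simp: M_def)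
  then have normal: "P \<lhd> G" by (intro normal_invI[OF P(1)]) (auto simp: M_def)
  interpret P: normal P G by (rule normal)
  \<comment> \<open>The order of the image of \<open>a\<close> modulo \<open>P\<close> divides both
    \<open>p ^ j\<close> and the index of \<open>P\<close>, which is prime to \<open>p\<close> by
    the choice of \<open>k\<close>.\<close>
  have "a \<in> P" if a: "a \<in> carrier G" and j: "a [^] (p ^ j) = \<one>" for a j
  proof -
    interpret Q: group_hom G "G Mod P" "\<lambda>a. P #> a"
      using P.r_coset_hom_Mod P.factorgroup_is_group
      by (simp add: group_hom_def group_hom_axioms_def is_group)
    have "order (G Mod P) * p ^ k = order G"
      using lagrange[OF P(1)] by (simp add: P order_def FactGroup_def)
    then have "\<not> p dvd order (G Mod P)"
      using o p k_def by (metis multiplicity_decompose mult_cancel_right mult_eq_0_iff not_prime_unit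
          nonzero_mult_div_cancel_right)
    then have "coprime (order (G Mod P)) (p ^ j)"
      using p by (simp add: coprime_commute prime_imp_coprime)
    moreover have "Q.H.ord (P #> a) dvd order (G Mod P)"
      using a by (simp add: Q.H.ord_dvd_group_order)
    moreover have "Q.H.ord (P #> a) dvd p ^ j"
      using a j by (simp add: Q.H.pow_eq_id[symmetric] flip: Q.hom_nat_pow)
    ultimately have "Q.H.ord (P #> a) = 1"
      by (meson coprime_common_divisor nat_dvd_1_iff_1)
    then have "P #> a = P" using a Q.H.ord_eq_1[of "P #> a"] by simp
    then show ?thesis using a P(1) by (rule coset_join1)
  qed
  moreover have "\<exists>j. a [^] (p ^ j) = \<one>" if "a \<in> P" for a
    using tors[OF P(1) that] P(2) by auto
  ultimately show ?thesis using P by blast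
qed

section \<open>Actions of groups of prime power order\<close>

text \<open>The restriction to \<open>E\<close> is there because \<open>BijGroup\<close> consists of
  extensional functions. Bijectivity is no premise: the action of the inverse element is an inverse
  map.\<close>

lemma group_actionI:
  assumes "group G"
    and closed: "\<And>g e. g \<in> carrier G \<Longrightarrow> e \<in> E \<Longrightarrow> f g e \<in> E"
    and one: "\<And>e. e \<in> E \<Longrightarrow> f \<one>\<^bsub>G\<^esub> e = e"
    and mult: "\<And>g h e. g \<in> carrier G \<Longrightarrow> h \<in> carrier G \<Longrightarrow> e \<in> E \<Longrightarrow>
      f (g \<otimes>\<^bsub>G\<^esub> h) e = f g (f h e)"
  shows "group_action G E (\<lambda>g. \<lambda>e\<in>E. f g e)"
proof -
  interpret group G by (rule assms(1))
  have inv: "f (inv\<^bsub>G\<^esub> g) (f g e) = e" if "g \<in> carrier G" "e \<in> E" for g e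
    using mult[of "inv\<^bsub>G\<^esub> g" g e] that one by simp
  have "bij_betw (f g) E E" if g: "g \<in> carrier G" for g
    using inv[OF g] inv[OF inv_closed[OF g]] closed g
    by (intro bij_betw_byWitness[of _ "f (inv\<^bsub>G\<^esub> g)"]) auto
  then have "(\<lambda>e\<in>E. f g e) \<in> Bij E" if "g \<in> carrier G" for g
    using that by (simp add: Bij_def)
  then show ?thesis
    using closed mult group_BijGroup[of E] assms(1)
    by (auto simp: group_action_def group_hom_def group_hom_axioms_def hom_def BijGroup_def
        compose_def restrict_def fun_eq_iff)
qed

lemma (in group_action) restrict_action:
  assumes "S \<subseteq> E" and "\<And>g e. g \<in> carrier G \<Longrightarrow> e \<in> S \<Longrightarrow> \<phi> g e \<in> S"
  shows "group_action G S (\<lambda>g. \<lambda>e\<in>S. \<phi> g e)"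
proof (rule group_actionI)
  show "group G" using group_hom by (simp add: group_hom_def)
  show "\<phi> \<one> e = e" if "e \<in> S" for e
    using id_eq_one that assms(1) by (metis restrict_apply' subsetD)
qed (use assms composition_rule in auto)

lemma (in group_action) card_orbit_prime_power:
  assumes p: "Factorial_Ring.prime (p::nat)" and G: "order G = p ^ k" and e: "e \<in> E"
  shows "\<exists>j. card (orbit G \<phi> e) = p ^ j"
proof -
  have "card (orbit G \<phi> e) dvd p ^ k"
    using orbit_stabilizer_theorem[OF e] G by (metis dvd_triv_left)
  then show ?thesis using divides_primepow_nat[OF p] by blast
qed

lemma (in group_action) prime_dvd_card_orbit:
  assumes p: "Factorial_Ring.prime (p::nat)" and G: "order G = p ^ k" and e: "e \<in> E"
    and g: "g \<in> carrier G" "\<phi> g e \<noteq> e"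
  shows "p dvd card (orbit G \<phi> e)"
proof -
  obtain j where j: "card (orbit G \<phi> e) = p ^ j"
    using card_orbit_prime_power[OF p G e] by blast
  have "j \<noteq> 0"
  proof
    assume "j = 0"
    then obtain y where "orbit G \<phi> e = {y}" using j by (auto simp: card_1_singleton_iff)
    moreover have "e \<in> orbit G \<phi> e" by (rule orbit_refl[OF e])
    moreover have "\<phi> g e \<in> orbit G \<phi> e" using g(1) by (auto simp: orbit_def)
    ultimately show False using g(2) by auto
  qed
  then show ?thesis using j by simp
qed

text \<open>An orbit is either a single fixed element or has size divisible by \<open>p\<close>. The
  indicator function \<open>?f\<close> lets both cardinalities be summed orbit by orbit.\<close>

lemma (in group_action) card_fixed_mod:
  assumes p: "Factorial_Ring.prime (p::nat)" and G: "order G = p ^ k" and fin: "finite E"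
  shows "card {e \<in> E. \<forall>g \<in> carrier G. \<phi> g e = e} mod p = card E mod p"
proof -
  let ?F = "{e \<in> E. \<forall>g \<in> carrier G. \<phi> g e = e}"
  let ?f = "\<lambda>e. if e \<in> ?F then 1 else (0::nat)"
  have orb: "(\<Sum>e\<in>B. ?f e) mod p = (\<Sum>e\<in>B. 1) mod p" if B: "B \<in> orbits G E \<phi>" for B
  proof -
    obtain e where e: "e \<in> E" "B = orbit G \<phi> e" using B by (auto simp: orbits_def)
    show ?thesis
    proof (cases "e \<in> ?F")
      case True
      then have "B = {e}" using e orbit_refl[OF e(1)] by (auto simp: orbit_def)
      then show ?thesis using True by simp
    next
      case False
      then have "p dvd card B" using prime_dvd_card_orbit[OF p G e(1)] e by auto
      \<comment> \<open>The orbit of a fixed element is a singleton, so the orbit of the unfixed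
        \<open>e\<close> contains none.\<close>
      moreover have "?f y = 0" if y: "y \<in> B" for y
      proof -
        have yE: "y \<in> E" using y e element_image by (auto simp: orbit_def)
        have "e \<in> orbit G \<phi> y" using orbit_sym[OF e(1) yE] y e by simp
        then have "e = y" if "y \<in> ?F" using that by (auto simp: orbit_def)
        then show ?thesis using False by auto
      qed
      ultimately show ?thesis by simp
    qed
  qed
  have "card ?F mod p = (\<Sum>e\<in>E. ?f e) mod p"
    using fin by (simp add: card_as_sums[of ?F E "\<lambda>e. e \<in> ?F"])
  also have "\<dots> = (\<Sum>B\<in>orbits G E \<phi>. (\<Sum>e\<in>B. ?f e) mod p) mod p"
    unfolding disjoint_sum[OF fin, symmetric] by (simp add: mod_sum_eq)
  also have "\<dots> = (\<Sum>B\<in>orbits G E \<phi>. (\<Sum>e\<in>B. 1) mod p) mod p"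
    using orb by simp
  also have "\<dots> = (\<Sum>e\<in>E. 1) mod p"
    unfolding disjoint_sum[OF fin, symmetric] by (simp only: mod_sum_eq)
  finally show ?thesis by simp
qed

section \<open>Counting in a finite projective plane\<close>

context projective_plane
begin

lemma line_point: "l \<in> lines \<Longrightarrow> p \<in> l \<Longrightarrow> p \<in> points"
  using lines_subset by blast

lemma line_eqI:
  "\<lbrakk>p \<in> l; q \<in> l; p \<in> m; q \<in> m; p \<noteq> q; l \<in> lines; m \<in> lines\<rbrakk> \<Longrightarrow> l = m"
  by (metis unique_point)

lemma join:
  assumes "p \<in> points" "q \<in> points" "p \<noteq> q"
  obtains l where "l \<in> lines" "p \<in> l" "q \<in> l"
  using unique_line[OF assms] by blast

lemma meet:
  assumes "l \<in> lines" "m \<in> lines" "l \<noteq> m"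
  obtains p where "p \<in> points" "p \<in> l" "p \<in> m"
proof -
  obtain p where "p \<in> l" "p \<in> m" using unique_point[OF assms] by blast
  then show thesis using that line_point[OF assms(1)] by blast
qed

lemma quadrangle_points:
  obtains a b c d where "{a, b, c, d} \<subseteq> points" "distinct [a, b, c, d]"
    "\<And>T l. T \<subseteq> {a, b, c, d} \<Longrightarrow> card T = 3 \<Longrightarrow> l \<in> lines \<Longrightarrow> \<not> T \<subseteq> l"
proof -
  obtain Q where Q: "Q \<subseteq> points" "card Q = 4"
    and nc: "\<forall>T \<subseteq> Q. card T = 3 \<longrightarrow> (\<forall>l \<in> lines. \<not> T \<subseteq> l)"
    using quadrangle by (elim exE conjE)
  have "finite Q" using Q(2) by (simp add: card_ge_0_finite)
  then obtain xs where xs: "set xs = Q" "distinct xs"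
    using finite_distinct_list by blast
  then have "length xs = 4" using Q(2) distinct_card[of xs] by simp
  then obtain a b c d where abcd: "xs = [a, b, c, d]"
    by (auto simp: numeral_eq_Suc length_Suc_conv)
  have "Q = {a, b, c, d}" using xs(1) abcd by simp
  show thesis
    by (rule that[of a b c d]) (use Q(1) xs(2) abcd nc \<open>Q = _\<close> in simp_all)
qed

text \<open>The three sides of a triangle have no common point.\<close>

lemma line_avoiding:
  obtains l where "l \<in> lines" "p \<notin> l"
proof (rule quadrangle_points)
  fix a b c d
  assume Q: "{a, b, c, d} \<subseteq> points" "distinct [a, b, c, d]"
    and nc: "\<And>T l. T \<subseteq> {a, b, c, d} \<Longrightarrow> card T = 3 \<Longrightarrow> l \<in> lines \<Longrightarrow> \<not> T \<subseteq> l"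
  have "card {a, b, c} = 3" using Q(2) by simp
  then have nc: "\<not> {a, b, c} \<subseteq> l" if "l \<in> lines" for l using nc[of "{a, b, c}" l] that by simp
  obtain k where k: "k \<in> lines" "a \<in> k" "b \<in> k" using Q by (auto intro: join[of a b])
  obtain l where l: "l \<in> lines" "b \<in> l" "c \<in> l" using Q by (auto intro: join[of b c])
  obtain m where m: "m \<in> lines" "a \<in> m" "c \<in> m" using Q by (auto intro: join[of a c])
  have "k \<noteq> l" "k \<noteq> m" using k l m nc[OF k(1)] by auto
  then have "p \<notin> k \<or> p \<notin> l \<or> p \<notin> m"
    using k l m Q(2) line_eqI[of a k p m] line_eqI[of b k p l] by auto
  then show thesis using that k l m by blast
qed

end

context finite_projective_plane
begin

lemma finite_lines: "finite lines"
  by (rule finite_subset[of _ "Pow points"]) (use finite_points lines_subset in auto)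

lemma finite_line: "l \<in> lines \<Longrightarrow> finite l"
  using lines_subset finite_points by (rule finite_subset)

text \<open>The intersection of the lines \<open>a b\<close> and \<open>c d\<close> of a quadrangle
  is a third point on \<open>a b\<close>.\<close>

lemma order_ge_2: "2 \<le> x"
proof (rule quadrangle_points)
  fix a b c d
  assume Q: "{a, b, c, d} \<subseteq> points" "distinct [a, b, c, d]"
    and nc: "\<And>T l. T \<subseteq> {a, b, c, d} \<Longrightarrow> card T = 3 \<Longrightarrow> l \<in> lines \<Longrightarrow> \<not> T \<subseteq> l"
  have "card {a, b, c} = 3" "card {a, c, d} = 3" "card {b, c, d} = 3" using Q(2) by simp_all
  then have nc: "\<not> {a, b, c} \<subseteq> l" "\<not> {a, c, d} \<subseteq> l" "\<not> {b, c, d} \<subseteq> l"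
    if "l \<in> lines" for l
    using nc[of "{a, b, c}" l] nc[of "{a, c, d}" l] nc[of "{b, c, d}" l] that by simp_all
  obtain k where k: "k \<in> lines" "a \<in> k" "b \<in> k" using Q by (auto intro: join[of a b])
  obtain l where l: "l \<in> lines" "c \<in> l" "d \<in> l" using Q by (auto intro: join[of c d])
  have "k \<noteq> l" using nc(1)[OF k(1)] k l by auto
  then obtain e where e: "e \<in> k" "e \<in> l" using k l by (auto intro: meet)
  have "e \<noteq> a" "e \<noteq> b" using e l nc(2,3)[OF l(1)] by auto
  then have "card {a, b, e} = 3" using Q by auto
  moreover have "{a, b, e} \<subseteq> k" using k e by auto
  ultimately have "3 \<le> card k" using card_mono[OF finite_line[OF k(1)]] by metis
  then show ?thesis using card_line[OF k(1)] by simp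
qed

text \<open>Double counting: each line of \<open>L\<close> meets \<open>l\<close> in exactly one
  point.\<close>

lemma sum_card_meeting_lines:
  assumes "l \<in> lines" "L \<subseteq> lines - {l}"
  shows "(\<Sum>p\<in>l. card {m \<in> L. p \<in> m}) = card L"
proof -
  have "card {p \<in> l. p \<in> m} = 1" if "m \<in> L" for m
  proof -
    have m: "m \<in> lines" "l \<noteq> m" using assms(2) that by auto
    obtain p where "p \<in> l" "p \<in> m" using meet[OF assms(1) m] by blast
    then have "{p \<in> l. p \<in> m} = {p}" using assms that line_eqI by blast
    then show ?thesis by simp
  qed
  moreover have "finite L" using assms finite_lines finite_subset by blast
  ultimately show ?thesis
    using sum_multicount_gen[of l L "\<lambda>p m. p \<in> m" "\<lambda>_. 1"] finite_line[OF assms(1)] by simp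
qed

text \<open>Joining with \<open>p\<close> matches the points of a line that avoids \<open>p\<close>
  with the lines through \<open>p\<close>.\<close>

lemma card_lines_through:
  assumes "p \<in> points"
  shows "card {l \<in> lines. p \<in> l} = x + 1"
proof -
  obtain l where l: "l \<in> lines" "p \<notin> l" by (rule line_avoiding)
  have "card {m \<in> {m \<in> lines. p \<in> m}. q \<in> m} = 1" if "q \<in> l" for q
  proof -
    have q: "p \<noteq> q" "q \<in> points" using that l line_point by auto
    obtain m where m: "m \<in> lines" "p \<in> m" "q \<in> m" by (rule join[OF assms q(2,1)])
    then have "{m \<in> {m \<in> lines. p \<in> m}. q \<in> m} = {m}" using line_eqI q by blast
    then show ?thesis by simp
  qed
  then have "(\<Sum>q\<in>l. card {m \<in> {m \<in> lines. p \<in> m}. q \<in> m}) = card l" by simp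
  moreover have "{m \<in> lines. p \<in> m} \<subseteq> lines - {l}" using l by auto
  ultimately show ?thesis using sum_card_meeting_lines[OF l(1)] card_line[OF l(1)] by metis
qed

text \<open>The lines through a point \<open>p\<close> partition the remaining points into
  \<open>x + 1\<close> classes of size \<open>x\<close>.\<close>

lemma card_points: "card points = x ^ 2 + x + 1"
proof -
  obtain l where l: "l \<in> lines" by (rule line_avoiding)
  have "l \<noteq> {}" using card_line[OF l] by auto
  then obtain p where p: "p \<in> points" using line_point[OF l] by blast
  let ?L = "{m \<in> lines. p \<in> m}"
  have "card {m \<in> ?L. q \<in> m} = 1" if "q \<in> points - {p}" for q
  proof -
    have q: "p \<noteq> q" "q \<in> points" using that by auto
    obtain m where m: "m \<in> lines" "p \<in> m" "q \<in> m" by (rule join[OF p q(2,1)])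
    then have "{m \<in> ?L. q \<in> m} = {m}" using line_eqI q by blast
    then show ?thesis by simp
  qed
  then have "(\<Sum>m\<in>?L. card {q \<in> points - {p}. q \<in> m}) = card (points - {p})"
    using sum_multicount_gen[of ?L "points - {p}" "\<lambda>m q. q \<in> m" "\<lambda>_. 1"]
      finite_lines finite_points by simp
  moreover have "card {q \<in> points - {p}. q \<in> m} = x" if m: "m \<in> ?L" for m
  proof -
    have "{q \<in> points - {p}. q \<in> m} = m - {p}" using m line_point by auto
    then show ?thesis using m card_line finite_line by simp
  qed
  ultimately have "card (points - {p}) = (x + 1) * x"
    using card_lines_through[OF p] by simp
  then have "card points = (x + 1) * x + 1" using card.remove[OF finite_points p] by simp
  then show ?thesis by (simp add: power2_eq_square)
qed

text \<open>Counting incident pairs from both sides gives as many lines as points.\<close>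

lemma card_lines: "card lines = x ^ 2 + x + 1"
proof -
  have "card {p \<in> points. p \<in> m} = x + 1" if m: "m \<in> lines" for m
  proof -
    have "{p \<in> points. p \<in> m} = m" using m line_point by auto
    then show ?thesis using m card_line by simp
  qed
  then have "(\<Sum>p\<in>points. card {m \<in> lines. p \<in> m}) = card lines * (x + 1)"
    using sum_multicount_gen[of points lines "\<lambda>p m. p \<in> m" "\<lambda>_. x + 1"] finite_lines finite_points
    by simp
  then have "card points * (x + 1) = card lines * (x + 1)"
    using card_lines_through by simp
  then have "card lines = card points" unfolding mult_cancel2 by simp
  then show ?thesis using card_points by simp
qed

lemma point_on_line_avoiding:
  assumes l: "l \<in> lines" and S: "finite S" "card S \<le> x"
  obtains p where "p \<in> l" "p \<notin> S"
proof -
  have "\<not> l \<subseteq> S" using card_mono[OF S(1), of l] card_line[OF l] S(2) by auto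
  then show thesis using that by blast
qed

lemma line_through_avoiding:
  assumes p: "p \<in> points" and S: "finite S" "card S \<le> x"
  obtains l where "l \<in> lines" "p \<in> l" "l \<notin> S"
proof -
  have "\<not> {l \<in> lines. p \<in> l} \<subseteq> S"
    using card_mono[OF S(1), of "{l \<in> lines. p \<in> l}"] card_lines_through[OF p] S(2) by auto
  then show thesis using that by blast
qed

end

section \<open>Fixed points and fixed lines\<close>

locale collineation_group = finite_projective_plane +
  fixes K
  assumes subgroup_K: "subgroup K (CollineationGroup points lines)"
begin

abbreviation "\<K> \<equiv> CollineationGroup points lines\<lparr>carrier := K\<rparr>"

definition "fixed_points = {p \<in> points. \<forall>g \<in> K. g p = p}"
definition "fixed_lines = {l \<in> lines. \<forall>g \<in> K. g ` l = l}"

sublocale points_action: group_action \<K> points "\<lambda>g. g"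
  by (rule group_action_collineations[OF subgroup_K])

sublocale group \<K>
  using points_action.group_hom by (simp add: group_hom_def)

lemma line_closed: "g \<in> K \<Longrightarrow> l \<in> lines \<Longrightarrow> g ` l \<in> lines"
  using subgroup.subset[OF subgroup_K] by (auto simp: CollineationGroup_def collineations_def)

lemma mult_apply: "g \<in> K \<Longrightarrow> h \<in> K \<Longrightarrow> p \<in> points \<Longrightarrow> (g \<otimes>\<^bsub>\<K>\<^esub> h) p = g (h p)"
  using points_action.composition_rule by simp

lemma one_apply: "p \<in> points \<Longrightarrow> \<one>\<^bsub>\<K>\<^esub> p = p"
  using points_action.id_eq_one by (metis restrict_apply')

lemma mult_image: "g \<in> K \<Longrightarrow> h \<in> K \<Longrightarrow> l \<in> lines \<Longrightarrow> (g \<otimes>\<^bsub>\<K>\<^esub> h) ` l = g ` h ` l"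
  using mult_apply line_point by (force simp: image_image intro!: image_cong)

lemma one_image: "l \<in> lines \<Longrightarrow> \<one>\<^bsub>\<K>\<^esub> ` l = l"
  using one_apply line_point by (force simp: image_def)

lemma inj_points: "g \<in> K \<Longrightarrow> inj_on g points"
  using points_action.inj_prop by simp

lemma inj_lines: "g \<in> K \<Longrightarrow> inj_on ((`) g) lines"
  using inj_points lines_subset by (meson inj_on_image_eq_iff inj_onI)

lemma eq_one:
  assumes g: "g \<in> K" and fixed: "\<And>p. p \<in> points \<Longrightarrow> g p = p"
  shows "g = \<one>\<^bsub>\<K>\<^esub>"
proof -
  have "g \<in> extensional points"
    using points_action.bij_prop0 g by (auto simp: Bij_def)
  then have "g = (\<lambda>p\<in>points. p)"
    using fixed by (auto simp: fun_eq_iff extensional_def)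
  then show ?thesis using points_action.id_eq_one by simp
qed

lemma lines_action: "group_action \<K> lines (\<lambda>g. \<lambda>l\<in>lines. g ` l)"
  by (rule group_actionI[OF is_group]) (use line_closed one_image mult_image in simp_all)

lemma fixed_point_of_lines:
  assumes g: "g \<in> K" and l: "l \<in> lines" "g ` l = l" and m: "m \<in> lines" "g ` m = m"
    and p: "l \<noteq> m" "p \<in> l" "p \<in> m"
  shows "g p = p"
proof -
  have "g p \<in> l" "g p \<in> m" using l m p by auto
  then show ?thesis using line_eqI[of p l "g p" m] l m p by auto
qed

lemma fixed_line_of_points:
  assumes g: "g \<in> K" and l: "l \<in> lines" and p: "p \<in> l" "g p = p" and q: "q \<in> l" "g q = q"
    and "p \<noteq> q"
  shows "g ` l = l"
proof -
  have "p \<in> g ` l" "q \<in> g ` l" using p q by force+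
  then show ?thesis using line_eqI[of p "g ` l" q l] line_closed[OF g l] l assms by auto
qed

text \<open>For \<open>p\<close> off both axes, every line through \<open>p\<close> that misses
  their intersection \<open>c\<close> meets them in two distinct fixed points and is therefore
  fixed. Two such lines determine \<open>p\<close>.\<close>

lemma eq_one_if_two_axes:
  assumes g: "g \<in> K" and l: "l \<in> lines" "\<And>p. p \<in> l \<Longrightarrow> g p = p"
    and m: "m \<in> lines" "\<And>p. p \<in> m \<Longrightarrow> g p = p" and "l \<noteq> m"
  shows "g = \<one>\<^bsub>\<K>\<^esub>"
proof (rule eq_one[OF g])
  fix p assume p: "p \<in> points"
  show "g p = p"
  proof (cases "p \<in> l \<or> p \<in> m")
    case False
    obtain c where c: "c \<in> points" "c \<in> l" "c \<in> m" by (rule meet[OF l(1) m(1) \<open>l \<noteq> m\<close>])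
    have pc: "p \<noteq> c" using False c by auto
    obtain k where k: "k \<in> lines" "p \<in> k" "c \<in> k" by (rule join[OF p c(1) pc])
    have fixed: "g ` n = n" if n: "n \<in> lines" "p \<in> n" "n \<noteq> k" for n
    proof -
      have cn: "c \<notin> n" using line_eqI[of p n c k] n k pc by blast
      have nl: "n \<noteq> l" "n \<noteq> m" using n False by auto
      obtain a where a: "a \<in> n" "a \<in> l" by (rule meet[OF n(1) l(1) nl(1)])
      obtain b where b: "b \<in> n" "b \<in> m" by (rule meet[OF n(1) m(1) nl(2)])
      have "a \<noteq> b" using line_eqI[of a l c m] a b cn c l(1) m(1) \<open>l \<noteq> m\<close> by blast
      then show ?thesis
        by (rule fixed_line_of_points[OF g n(1) a(1) l(2)[OF a(2)] b(1) m(2)[OF b(2)]])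
    qed
    obtain n where n: "n \<in> lines" "p \<in> n" "n \<notin> {k}"
      by (rule line_through_avoiding[OF p, of "{k}"]) (use order_ge_2 in auto)
    \<comment> \<open>\<open>x \<ge> 2\<close> is just enough to exclude two of the
      \<open>x + 1\<close> lines through \<open>p\<close>.\<close>
    obtain n' where n': "n' \<in> lines" "p \<in> n'" "n' \<notin> {k, n}"
      by (rule line_through_avoiding[OF p, of "{k, n}"])
        (use order_ge_2 card_insert_le_m1[of 2 "{n}" k] in auto)
    have ne: "n \<noteq> k" "n' \<noteq> k" "n \<noteq> n'" using n(3) n'(3) by auto
    show ?thesis
      by (rule fixed_point_of_lines[OF g n(1) fixed[OF n(1,2) ne(1)]
        n'(1) fixed[OF n'(1,2) ne(2)] ne(3) n(2) n'(2)])
  qed (use l m in auto)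
qed

text \<open>A point off the line \<open>k\<close> joining the centres is the meet of its two fixed
  joins with them. A point on \<open>k\<close> is the meet of two further lines, each fixed because
  it carries two fixed points off \<open>k\<close>.\<close>

lemma eq_one_if_two_centres:
  assumes g: "g \<in> K" and a: "a \<in> points" "\<And>l. l \<in> lines \<Longrightarrow> a \<in> l \<Longrightarrow> g ` l = l"
    and b: "b \<in> points" "\<And>l. l \<in> lines \<Longrightarrow> b \<in> l \<Longrightarrow> g ` l = l" and "a \<noteq> b"
  shows "g = \<one>\<^bsub>\<K>\<^esub>"
proof -
  obtain k where k: "k \<in> lines" "a \<in> k" "b \<in> k" by (rule join[OF a(1) b(1) \<open>a \<noteq> b\<close>])
  have off: "g p = p" if p: "p \<in> points" "p \<notin> k" for p
  proof -
    have ne: "p \<noteq> a" "p \<noteq> b" using p k by auto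
    obtain l where l: "l \<in> lines" "p \<in> l" "a \<in> l" by (rule join[OF p(1) a(1) ne(1)])
    obtain m where m: "m \<in> lines" "p \<in> m" "b \<in> m" by (rule join[OF p(1) b(1) ne(2)])
    have "l \<noteq> m" using line_eqI[of a l b k] l m k p \<open>a \<noteq> b\<close> by blast
    then show ?thesis
      by (rule fixed_point_of_lines[OF g l(1) a(2)[OF l(1,3)] m(1) b(2)[OF m(1,3)] _ l(2) m(2)])
  qed
  show ?thesis
  proof (rule eq_one[OF g])
    fix p assume p: "p \<in> points"
    show "g p = p"
    proof (cases "p \<in> k")
      case True
      have fixed: "g ` n = n" if n: "n \<in> lines" "p \<in> n" "n \<noteq> k" for n
      proof -
        have nk: "q \<notin> k" if "q \<in> n" "q \<noteq> p" for q
          using line_eqI[of p n q k] n k True that by blast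
        obtain q where q: "q \<in> n" "q \<notin> {p}"
          by (rule point_on_line_avoiding[OF n(1), of "{p}"]) (use order_ge_2 in auto)
        obtain q' where q': "q' \<in> n" "q' \<notin> {p, q}"
          by (rule point_on_line_avoiding[OF n(1), of "{p, q}"])
            (use order_ge_2 card_insert_le_m1[of 2 "{q}" p] in auto)
        have "g q = q" "g q' = q'"
          using off[OF line_point[OF n(1) q(1)] nk[OF q(1)]]
            off[OF line_point[OF n(1) q'(1)] nk[OF q'(1)]] q(2) q'(2) by simp_all
        moreover have "q \<noteq> q'" using q'(2) by auto
        ultimately show ?thesis by (intro fixed_line_of_points[OF g n(1) q(1) _ q'(1)])
      qed
      obtain n where n: "n \<in> lines" "p \<in> n" "n \<notin> {k}"
        by (rule line_through_avoiding[OF p, of "{k}"]) (use order_ge_2 in auto)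
      obtain n' where n': "n' \<in> lines" "p \<in> n'" "n' \<notin> {k, n}"
        by (rule line_through_avoiding[OF p, of "{k, n}"])
          (use order_ge_2 card_insert_le_m1[of 2 "{n}" k] in auto)
      have ne: "n \<noteq> k" "n' \<noteq> k" "n \<noteq> n'" using n(3) n'(3) by auto
      show ?thesis
        by (rule fixed_point_of_lines[OF g n(1) fixed[OF n(1,2) ne(1)]
        n'(1) fixed[OF n'(1,2) ne(2)] ne(3) n(2) n'(2)])
    qed (rule off[OF p])
  qed
qed

text \<open>Any two points are then centres; thus the action on lines is faithful.\<close>

lemma eq_one_if_lines_fixed:
  assumes g: "g \<in> K" and fixed: "\<And>l. l \<in> lines \<Longrightarrow> g ` l = l"
  shows "g = \<one>\<^bsub>\<K>\<^esub>"
proof -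
  obtain l where l: "l \<in> lines" by (rule line_avoiding)
  have "\<not> card l \<le> Suc 0" using card_line[OF l] order_ge_2 by simp
  then obtain a b where ab: "a \<in> l" "b \<in> l" "a \<noteq> b"
    using card_le_Suc0_iff_eq[OF finite_line[OF l]] by blast
  show ?thesis
    by (rule eq_one_if_two_centres[OF g line_point[OF l ab(1)] fixed line_point[OF l ab(2)] fixed ab(3)])
qed

section \<open>Fixed points and fixed lines of groups of prime power order\<close>

lemma card_fixed_points_mod:
  assumes "Factorial_Ring.prime (r::nat)" "card K = r ^ k"
  shows "card fixed_points mod r = card points mod r"
proof -
  have "order \<K> = r ^ k" using assms(2) by (simp add: order_def)
  from points_action.card_fixed_mod[OF assms(1) this finite_points]
  show ?thesis by (simp add: fixed_points_def)
qed

lemma card_fixed_points_on_line_mod: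
  assumes "Factorial_Ring.prime (r::nat)" "card K = r ^ k" and l: "l \<in> fixed_lines"
  shows "card (l \<inter> fixed_points) mod r = (x + 1) mod r"
proof -
  have l': "l \<in> lines" "\<And>g. g \<in> K \<Longrightarrow> g ` l = l" using l by (auto simp: fixed_lines_def)
  interpret A: group_action \<K> l "\<lambda>g. \<lambda>p\<in>l. g p"
    by (rule points_action.restrict_action[OF lines_subset[OF l'(1)]]) (use l'(2) in auto)
  have "{p \<in> l. \<forall>g \<in> carrier \<K>. (\<lambda>p\<in>l. g p) p = p} = l \<inter> fixed_points"
    using line_point[OF l'(1)] by (auto simp: fixed_points_def)
  moreover have "order \<K> = r ^ k" using assms(2) by (simp add: order_def)
  ultimately show ?thesis
    using A.card_fixed_mod[OF assms(1) _ finite_line[OF l'(1)], of k] card_line[OF l'(1)] by simp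
qed

lemma pencil_action:
  assumes p: "p \<in> fixed_points"
  shows "group_action \<K> {l \<in> lines. p \<in> l} (\<lambda>g. \<lambda>l\<in>{l \<in> lines. p \<in> l}. g ` l)"
proof (rule group_actionI[OF is_group])
  fix g l assume g: "g \<in> carrier \<K>" and l: "l \<in> {l \<in> lines. p \<in> l}"
  have "g p = p" using g p by (auto simp: fixed_points_def)
  then have "p \<in> g ` l" using l by force
  then show "g ` l \<in> {l \<in> lines. p \<in> l}" using g l line_closed by simp
qed (use one_image mult_image in simp_all)

lemma card_fixed_lines_through_mod:
  assumes "Factorial_Ring.prime (r::nat)" "card K = r ^ k" and p: "p \<in> fixed_points"
  shows "card {l \<in> fixed_lines. p \<in> l} mod r = (x + 1) mod r"
proof -
  let ?L = "{l \<in> lines. p \<in> l}"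
  interpret A: group_action \<K> ?L "\<lambda>g. \<lambda>l\<in>?L. g ` l" by (rule pencil_action[OF p])
  have "{l \<in> ?L. \<forall>g \<in> carrier \<K>. (\<lambda>l\<in>?L. g ` l) l = l} = {l \<in> fixed_lines. p \<in> l}"
    by (auto simp: fixed_lines_def)
  moreover have "order \<K> = r ^ k" using assms(2) by (simp add: order_def)
  moreover have "p \<in> points" using p by (simp add: fixed_points_def)
  ultimately show ?thesis
    using A.card_fixed_mod[OF assms(1), of k] finite_lines card_lines_through by simp
qed

text \<open>Some fixed line \<open>l\<close> through \<open>p\<close> contains a moved point \<open>b\<close>. The lines joining \<open>b\<close> to the fixed
  points off \<open>l\<close> are distinct, and the other fixed lines through \<open>p\<close> supply two such points each.\<close>
lemma few_fixed_lines_through: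
  assumes nontriv: "K \<noteq> {\<one>\<^bsub>\<K>\<^esub>}" and p: "p \<in> fixed_points"
    and three: "\<And>l. l \<in> fixed_lines \<Longrightarrow> 3 \<le> card (l \<inter> fixed_points)"
    and two: "2 \<le> card {l \<in> fixed_lines. p \<in> l}"
  shows "2 * (card {l \<in> fixed_lines. p \<in> l} - 1) \<le> x"
proof -
  let ?L = "{l \<in> fixed_lines. p \<in> l}"
  have fin: "finite ?L" using finite_lines by (auto simp: fixed_lines_def)
  \<comment> \<open>Otherwise two fixed lines through \<open>p\<close> would be pointwise fixed, and
    two axes make the group trivial.\<close>
  have "\<exists>l b. l \<in> ?L \<and> b \<in> l \<and> b \<notin> fixed_points"
  proof (rule ccontr)
    assume neg: "\<not> ?thesis"
    have "\<not> card ?L \<le> Suc 0" using two by simp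
    then obtain l m where lm: "l \<in> ?L" "m \<in> ?L" "l \<noteq> m"
      using card_le_Suc0_iff_eq[OF fin] by blast
    have axis: "g q = q" if "g \<in> K" "n \<in> ?L" "q \<in> n" for g n q
    proof -
      have "q \<in> fixed_points" using neg that by blast
      then show ?thesis using that(1) by (simp add: fixed_points_def)
    qed
    have lines: "l \<in> lines" "m \<in> lines" using lm by (simp_all add: fixed_lines_def)
    have "g = \<one>\<^bsub>\<K>\<^esub>" if g: "g \<in> K" for g
      by (rule eq_one_if_two_axes[OF g lines(1) axis[OF g lm(1)] lines(2) axis[OF g lm(2)] lm(3)])
    moreover have "\<one>\<^bsub>\<K>\<^esub> \<in> K" using one_closed by simp
    ultimately have "K = {\<one>\<^bsub>\<K>\<^esub>}" by blast
    then show False using nontriv by simp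
  qed
  then obtain l b where l: "l \<in> ?L" and b: "b \<in> l" "b \<notin> fixed_points" by blast
  have ll: "l \<in> lines" using l by (simp add: fixed_lines_def)
  have bp: "b \<in> points" using line_point[OF ll b(1)] .
  obtain h where h: "h \<in> K" "h b \<noteq> b" using b(2) bp by (auto simp: fixed_points_def)
  let ?A = "fixed_points - l"
  have finA: "finite ?A" using finite_points by (simp add: fixed_points_def)
  have "card ?A \<le> card ({m \<in> lines. b \<in> m} - {l})"
  proof -
    have "\<exists>m. m \<in> lines \<and> b \<in> m \<and> q \<in> m" if q: "q \<in> ?A" for q
    proof -
      have "q \<in> points" "b \<noteq> q" using q b by (auto simp: fixed_points_def)
      then show ?thesis using join[OF bp] by metis
    qed
    then obtain f where f: "\<And>q. q \<in> ?A \<Longrightarrow> f q \<in> lines \<and> b \<in> f q \<and> q \<in> f q" by metis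
    \<comment> \<open>A line through \<open>b\<close> with two fixed points off \<open>l\<close>
      would be fixed by \<open>h\<close>, so \<open>b\<close>, its meet with \<open>l\<close>, would
      be fixed too.\<close>
    have "inj_on f ?A"
    proof (rule inj_onI, rule ccontr)
      fix q s assume q: "q \<in> ?A" and s: "s \<in> ?A" and eq: "f q = f s" and "q \<noteq> s"
      have "h q = q" "h s = s" using q s h by (auto simp: fixed_points_def)
      then have "h ` f q = f q"
        using fixed_line_of_points[OF h(1), of "f q" q s] f[OF q] f[OF s] eq \<open>q \<noteq> s\<close> by auto
      moreover have "h ` l = l" using l h by (auto simp: fixed_lines_def)
      moreover have "f q \<noteq> l" using f[OF q] q by auto
      ultimately have "h b = b"
        using fixed_point_of_lines[OF h(1) _ _ ll] f[OF q] b by blast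
      then show False using h by simp
    qed
    moreover have "f ` ?A \<subseteq> {m \<in> lines. b \<in> m} - {l}" using f by auto
    ultimately show ?thesis using finite_lines by (intro card_inj_on_le[of f]) auto
  qed
  also have "\<dots> = x" using card_lines_through[OF bp] ll b finite_lines by simp
  finally have upper: "card ?A \<le> x" .
  have disj: "(m \<inter> fixed_points - {p}) \<inter> (m' \<inter> fixed_points - {p}) = {}"
    if "m \<in> ?L" "m' \<in> ?L" "m \<noteq> m'" for m m'
    using that line_eqI[of p m _ m'] by (auto simp: fixed_lines_def)
  have "2 * card (?L - {l}) \<le> (\<Sum>m\<in>?L - {l}. card (m \<inter> fixed_points - {p}))"
  proof -
    have "2 \<le> card (m \<inter> fixed_points - {p})" if m: "m \<in> ?L - {l}" for m
      using three[of m] m p finite_points by (simp add: fixed_points_def card_Diff_singleton_if)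
    then show ?thesis
      using sum_bounded_below[of "?L - {l}" "2::nat"] by (simp add: mult.commute)
  qed
  also have "\<dots> = card (\<Union>m\<in>?L - {l}. m \<inter> fixed_points - {p})"
    using fin disj finite_points
    by (intro card_UN_disjoint[symmetric]) (auto simp: fixed_points_def)
  also have "\<dots> \<le> card ?A"
  proof (rule card_mono[OF finA])
    show "(\<Union>m\<in>?L - {l}. m \<inter> fixed_points - {p}) \<subseteq> ?A"
      using disj[OF l] by blast
  qed
  finally show ?thesis using upper fin l by simp
qed

end

section \<open>Prime divisors of the number of points\<close>

text \<open>Modulo \<open>r\<close>, \<open>x \<equiv> c - 1\<close> gives \<open>x\<^sup>2 + x + 1 \<equiv> c\<^sup>2 - c + 1\<close>, which is \<open>1\<close>, \<open>1\<close> or \<open>3\<close> for \<open>c < 3\<close>.\<close>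
lemma three_le_if_cong_order_plus_1:
  fixes c x r :: nat
  assumes r: "5 \<le> r" "r dvd x ^ 2 + x + 1" and c: "c mod r = (x + 1) mod r"
  shows "3 \<le> c"
proof (rule ccontr)
  assume "\<not> 3 \<le> c"
  then have small: "c = 0 \<or> c = 1 \<or> c = 2" by auto
  have "int c mod int r = int (x + 1) mod int r" using c by (metis zmod_int)
  then have "int r dvd int (x + 1) - int c" by (metis mod_eq_dvd_iff)
  \<comment> \<open>The cofactor \<open>x + c\<close> is chosen so that subtracting the product from
    \<open>x ^ 2 + x + 1\<close> eliminates \<open>x\<close>.\<close>
  then have "int r dvd (int x + 1 - int c) * (int x + int c)" by (simp add: add.commute)
  moreover have "int r dvd int (x ^ 2 + x + 1)" using r(2) by (simp only: int_dvd_int_iff)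
  ultimately have "int r dvd int (x ^ 2 + x + 1) - (int x + 1 - int c) * (int x + int c)"
    by (rule dvd_diff[rotated])
  also have "\<dots> = int c ^ 2 - int c + 1" by (simp add: power2_eq_square algebra_simps)
  finally have "int r dvd 1 \<or> int r dvd 3" using small by auto
  then have "int r \<le> 3" by (auto dest: zdvd_imp_le)
  then show False using r(1) by simp
qed

text \<open>A check of all residues modulo \<open>9\<close>; it limits line orbits of a
  \<open>3\<close>-group to size at most \<open>3\<close>.\<close>

lemma nine_not_dvd: "\<not> 9 dvd x ^ 2 + x + (1::nat)"
proof
  assume "9 dvd x ^ 2 + x + 1"
  moreover have "((x mod 9) ^ 2 + x mod 9 + 1) mod 9 = (x ^ 2 + x + 1) mod 9"
    by (intro mod_add_cong) (simp_all add: power_mod)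
  ultimately have eq: "((x mod 9) ^ 2 + x mod 9 + 1) mod 9 = 0" by (simp only: dvd_eq_mod_eq_0)
  have "(a ^ 2 + a + 1) mod 9 \<noteq> 0" if "a < 9" for a :: nat
  proof -
    have "a = 0 \<or> a = 1 \<or> a = 2 \<or> a = 3 \<or> a = 4 \<or> a = 5 \<or> a = 6 \<or> a = 7 \<or> a = 8"
      using that by linarith
    then show ?thesis by (elim disjE) simp_all
  qed
  from this[of "x mod 9"] show False using eq by (metis mod_less_divisor zero_less_numeral)
qed

text \<open>This exploits that the order is a square. A prime dividing both factors
  \<open>u^2 + u + 1\<close> and \<open>u^2 - u + 1\<close> divides their difference
  \<open>2 * u\<close>, but neither \<open>2\<close>, since the factors are odd, nor
  \<open>u\<close>. So the prime power divides one factor, and the larger one bounds it.\<close>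

lemma prime_power_le_of_square_order:
  fixes u r j :: nat
  assumes r: "Factorial_Ring.prime r" and u: "0 < u" and dvd: "r ^ j dvd (u ^ 2) ^ 2 + u ^ 2 + 1"
  shows "r ^ j \<le> u ^ 2 + u + 1"
proof -
  \<comment> \<open>With \<open>u = w + 1\<close>, the factor \<open>u^2 - u + 1\<close> becomes
    \<open>w^2 + w + 1\<close>, without subtraction on naturals.\<close>
  obtain w where w: "u = Suc w" using u by (cases u) auto
  let ?a = "u ^ 2 + u + 1" and ?b = "w ^ 2 + w + 1"
  have prod: "(u ^ 2) ^ 2 + u ^ 2 + 1 = ?a * ?b"
    by (simp add: w power2_eq_square algebra_simps)
  have "\<not> (r dvd ?a \<and> r dvd ?b)"
  proof
    assume ab: "r dvd ?a \<and> r dvd ?b"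
    have "?a = ?b + 2 * u" by (simp add: w power2_eq_square)
    then have "r dvd 2 * u" using ab dvd_add_right_iff by metis
    then have "r dvd 2 \<or> r dvd u" using r by (simp add: prime_dvd_mult_iff)
    moreover have "\<not> r dvd u"
    proof
      assume "r dvd u"
      then have "r dvd u ^ 2 + u" by (simp add: power2_eq_square)
      then have "r dvd 1" using ab dvd_add_right_iff by blast
      then show False using r by simp
    qed
    moreover have "\<not> r dvd 2"
    proof
      assume "r dvd 2"
      then have "r = 2" using r by (meson two_is_prime_nat primes_dvd_imp_eq)
      moreover have "odd ?a" by simp
      ultimately show False using ab by simp
    qed
    ultimately show False by blast
  qed
  then have "coprime (r ^ j) ?a \<or> coprime (r ^ j) ?b"
    using r by (metis coprime_power_left_iff prime_imp_coprime)
  then have "r ^ j dvd ?a \<or> r ^ j dvd ?b"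
    using dvd unfolding prod by (metis coprime_dvd_mult_left_iff coprime_dvd_mult_right_iff)
  then have "r ^ j \<le> ?a \<or> r ^ j \<le> ?b" using dvd_imp_le by auto
  moreover have "?b \<le> ?a" by (simp add: w power2_eq_square)
  ultimately show ?thesis by linarith
qed

section \<open>Normal subgroups of a transitive group\<close>

locale transitive_collineation_group = collineation_group +
  assumes transitive: "p \<in> points \<Longrightarrow> q \<in> points \<Longrightarrow> \<exists>g\<in>K. g p = q"
begin

text \<open>If every point lies on \<open>k\<close> lines of the orbit \<open>L\<close> of \<open>l\<close>, then counting along a line outside
  \<open>L\<close> gives \<open>card L = (x + 1) k\<close>, whereas counting along \<open>l\<close> gives \<open>card L = (x + 1) k - x\<close>.\<close>
lemma line_transitive:
  assumes l: "l \<in> lines" and m: "m \<in> lines"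
  shows "\<exists>g\<in>K. g ` l = m"
proof (rule ccontr)
  assume neg: "\<not> ?thesis"
  define L where "L = (\<lambda>g. g ` l) ` K"
  have L: "L \<subseteq> lines" using l line_closed by (auto simp: L_def)
  have finL: "finite L" using finite_subset[OF L finite_lines] .
  have "\<one>\<^bsub>\<K>\<^esub> \<in> K" using one_closed by simp
  then have lL: "l \<in> L" unfolding L_def using one_image[OF l] by (metis image_eqI)
  have mL: "m \<notin> L" using neg by (auto simp: L_def)
  let ?k = "\<lambda>p. card {n \<in> L. p \<in> n}"
  have le: "?k p \<le> ?k q" if p: "p \<in> points" and q: "q \<in> points" for p q
  proof -
    obtain g where g: "g \<in> K" "g p = q" using transitive[OF p q] by blast
    have "g ` n \<in> L" if n: "n \<in> L" for n
    proof -
      obtain h where h: "h \<in> K" "n = h ` l" using n by (auto simp: L_def)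
      then have "g ` n = (g \<otimes>\<^bsub>\<K>\<^esub> h) ` l" using mult_image g l by simp
      moreover have "g \<otimes>\<^bsub>\<K>\<^esub> h \<in> K" using m_closed[of g h] g h by simp
      ultimately show ?thesis by (auto simp: L_def)
    qed
    then have "(`) g ` {n \<in> L. p \<in> n} \<subseteq> {n \<in> L. q \<in> n}" using g by blast
    moreover have "inj_on ((`) g) {n \<in> L. p \<in> n}"
      by (rule inj_on_subset[OF inj_lines[OF g(1)]]) (use L in auto)
    ultimately show ?thesis using finL by (intro card_inj_on_le[of "(`) g"]) auto
  qed
  obtain a where a: "a \<in> l" by (rule point_on_line_avoiding[OF l, of "{}"]) auto
  have k: "?k p = ?k a" if "p \<in> points" for p
    using le[OF that line_point[OF l a]] le[OF line_point[OF l a] that] by simp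
  have "card L = (\<Sum>p\<in>m. ?k p)"
    by (rule sum_card_meeting_lines[OF m, symmetric]) (use L mL in blast)
  also have "\<dots> = (\<Sum>p\<in>m. ?k a)" by (rule sum.cong) (use k line_point[OF m] in auto)
  finally have 1: "card L = (x + 1) * ?k a" using card_line[OF m] by simp
  have "card (L - {l}) = (\<Sum>p\<in>l. card {n \<in> L - {l}. p \<in> n})"
    by (rule sum_card_meeting_lines[OF l, symmetric]) (use L in blast)
  also have "\<dots> = (\<Sum>p\<in>l. ?k a - 1)"
  proof (rule sum.cong)
    fix p assume p: "p \<in> l"
    have "{n \<in> L - {l}. p \<in> n} = {n \<in> L. p \<in> n} - {l}" by auto
    then show "card {n \<in> L - {l}. p \<in> n} = ?k a - 1"
      using k[OF line_point[OF l p]] p lL finL by simp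
  qed simp
  finally have 2: "card L - 1 = (x + 1) * (?k a - 1)" using card_line[OF l] lL finL by simp
  have "?k a > 0" using a lL finL by (auto simp: card_gt_0_iff)
  then obtain k where "?k a = Suc k" using gr0_implies_Suc by blast
  \<comment> \<open>With \<open>?k a = Suc k\<close>, the two counts of \<open>L\<close> differ by
    \<open>x\<close>, which is not \<open>0\<close>.\<close>
  then show False using 1 2 order_ge_2 by (simp add: algebra_simps)
qed

end

section \<open>Line orbits of a normal subgroup\<close>

locale transitive_normal = transitive_collineation_group +
  fixes N
  assumes normal_N: "N \<lhd> \<K>"
begin

lemma subgroup_N: "subgroup N (CollineationGroup points lines)"
  using group.incl_subgroup[OF group_CollineationGroup subgroup_K normal_imp_subgroup[OF normal_N]] .

sublocale N: collineation_group points lines x N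
  by (intro collineation_group.intro collineation_group_axioms.intro
      finite_projective_plane_axioms subgroup_N)

definition "line_orbit l = (\<lambda>g. g ` l) ` N"

lemma N_subset: "N \<subseteq> K"
  using subgroup.subset[OF normal_imp_subgroup[OF normal_N]] by simp

lemma line_orbit_subset: "l \<in> lines \<Longrightarrow> line_orbit l \<subseteq> lines"
  using N.line_closed by (auto simp: line_orbit_def)

lemma finite_line_orbit: "l \<in> lines \<Longrightarrow> finite (line_orbit l)"
  using line_orbit_subset finite_lines finite_subset by blast

lemma line_orbit_eq: "l \<in> lines \<Longrightarrow> line_orbit l = orbit N.\<K> (\<lambda>g. \<lambda>l\<in>lines. g ` l) l"
  by (auto simp: line_orbit_def orbit_def)

lemma self_in_line_orbit: "l \<in> lines \<Longrightarrow> l \<in> line_orbit l"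
  using group_action.orbit_refl[OF N.lines_action] by (simp add: line_orbit_eq)

text \<open>Since \<open>g n = (g n g^-1) g\<close> and the conjugate lies in \<open>N\<close>, the
  line orbits of \<open>N\<close> are blocks for \<open>K\<close>.\<close>

lemma image_line_orbit:
  assumes g: "g \<in> K" and l: "l \<in> lines" and m: "m \<in> line_orbit l"
  shows "g ` m \<in> line_orbit (g ` l)"
proof -
  obtain n where n: "n \<in> N" "m = n ` l" using m by (auto simp: line_orbit_def)
  let ?n = "g \<otimes>\<^bsub>\<K>\<^esub> n \<otimes>\<^bsub>\<K>\<^esub> inv\<^bsub>\<K>\<^esub> g"
  have nK: "n \<in> K" using n N_subset by auto
  have n': "?n \<in> N" using normal.inv_op_closed2[OF normal_N, of g n] g n by simp
  then have n'K: "?n \<in> K" using N_subset by blast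
  have "g \<in> carrier \<K>" "n \<in> carrier \<K>" using g nK by simp_all
  then have "?n \<otimes>\<^bsub>\<K>\<^esub> g = g \<otimes>\<^bsub>\<K>\<^esub> n"
    by (metis m_assoc m_closed inv_closed l_inv r_one)
  then have "?n ` g ` l = g ` n ` l"
    by (metis mult_image[OF n'K g l] mult_image[OF g nK l])
  then have "g ` m = ?n ` g ` l" by (simp only: n(2))
  then show ?thesis unfolding line_orbit_def using n' by (rule image_eqI)
qed

lemma card_line_orbit_eq:
  assumes l: "l \<in> lines" and m: "m \<in> lines"
  shows "card (line_orbit l) = card (line_orbit m)"
proof -
  have "card (line_orbit l) \<le> card (line_orbit m)" if l: "l \<in> lines" and m: "m \<in> lines" for l m
  proof -
    obtain g where g: "g \<in> K" "g ` l = m" using line_transitive[OF l m] by blast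
    have sub: "(`) g ` line_orbit l \<subseteq> line_orbit m" using image_line_orbit[OF g(1) l] g(2) by blast
    have "inj_on ((`) g) (line_orbit l)"
      using inj_lines[OF g(1)] line_orbit_subset[OF l] by (rule inj_on_subset)
    then show ?thesis using sub finite_line_orbit[OF m] by (rule card_inj_on_le)
  qed
  from this[OF l m] this[OF m l] show ?thesis by simp
qed

text \<open>The orbits partition the lines into classes of equal size, and there are
  \<open>x ^ 2 + x + 1\<close> lines.\<close>

lemma card_line_orbit_dvd:
  assumes l: "l \<in> lines"
  shows "card (line_orbit l) dvd x ^ 2 + x + 1"
proof -
  interpret A: group_action N.\<K> lines "\<lambda>g. \<lambda>l\<in>lines. g ` l" by (rule N.lines_action)
  let ?O = "orbits N.\<K> lines (\<lambda>g. \<lambda>l\<in>lines. g ` l)"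
  have "card B = card (line_orbit l)" if B: "B \<in> ?O" for B
  proof -
    obtain m where m: "m \<in> lines" "B = orbit N.\<K> (\<lambda>g. \<lambda>l\<in>lines. g ` l) m"
      using B by (auto simp: orbits_def)
    then have "B = line_orbit m" using line_orbit_eq by simp
    then show ?thesis using card_line_orbit_eq[OF l m(1)] by simp
  qed
  then have "(\<Sum>B\<in>?O. \<Sum>m\<in>B. 1) = card ?O * card (line_orbit l)" by simp
  then have "card lines = card ?O * card (line_orbit l)"
    using A.disjoint_sum[OF finite_lines, of "\<lambda>_. 1::nat"] by simp
  then show ?thesis unfolding card_lines by simp
qed

definition "pencil_pairs p = (SIGMA l:{l \<in> lines. p \<in> l}. {m \<in> line_orbit l - {l}. p \<in> m})"

lemma finite_pencil_pairs: "finite (pencil_pairs p)"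
  using finite_lines finite_line_orbit by (auto simp: pencil_pairs_def)

lemma card_pencil_pairs_eq:
  assumes p: "p \<in> points" and q: "q \<in> points"
  shows "card (pencil_pairs p) = card (pencil_pairs q)"
proof -
  have "card (pencil_pairs p) \<le> card (pencil_pairs q)"
    if p: "p \<in> points" and q: "q \<in> points" for p q
  proof -
    obtain g where g: "g \<in> K" "g p = q" using transitive[OF p q] by blast
    let ?f = "map_prod ((`) g) ((`) g)"
    have sub: "pencil_pairs p \<subseteq> lines \<times> lines"
      using line_orbit_subset by (auto simp: pencil_pairs_def)
    have "inj_on ?f (lines \<times> lines)"
      by (rule map_prod_inj_on) (rule inj_lines[OF g(1)])+
    then have inj: "inj_on ?f (pencil_pairs p)" using sub by (rule inj_on_subset)
    have "?f ` pencil_pairs p \<subseteq> pencil_pairs q"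
    proof
      fix z assume "z \<in> ?f ` pencil_pairs p"
      then obtain l m where z: "z = (g ` l, g ` m)" and l: "l \<in> lines" "p \<in> l"
        and m: "m \<in> line_orbit l" "m \<noteq> l" "p \<in> m"
        by (auto simp: pencil_pairs_def)
      have "m \<in> lines" using m line_orbit_subset[OF l(1)] by auto
      then have "g ` m \<noteq> g ` l" using inj_onD[OF inj_lines[OF g(1)]] l m by blast
      moreover have "q \<in> g ` l" "q \<in> g ` m" using g l m by blast+
      ultimately show "z \<in> pencil_pairs q"
        using z image_line_orbit[OF g(1) l(1) m(1)] line_closed[OF g(1) l(1)]
        by (simp add: pencil_pairs_def)
    qed
    with inj show ?thesis using finite_pencil_pairs by (rule card_inj_on_le)
  qed
  from this[OF p q] this[OF q p] show ?thesis by simp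
qed

text \<open>Summed over all points, the pairs are counted line by line: each line has
  \<open>card (line_orbit l) - 1\<close> companions in its orbit and meets each in one point. The
  summand does not depend on the point, and there are as many points as lines.\<close>

lemma card_pencil_pairs:
  assumes p: "p \<in> points" and l: "l \<in> lines"
  shows "card (pencil_pairs p) = card (line_orbit l) - 1"
proof -
  let ?c = "\<lambda>q m. card {n \<in> line_orbit m - {m}. q \<in> n}"
  have "card points * card (pencil_pairs p) = (\<Sum>q\<in>points. card (pencil_pairs p))" by simp
  also have "\<dots> = (\<Sum>q\<in>points. card (pencil_pairs q))"
    by (rule sum.cong[OF refl card_pencil_pairs_eq[OF p]])
  also have "\<dots> = (\<Sum>q\<in>points. \<Sum>m\<in>{m \<in> lines. q \<in> m}. ?c q m)"
    unfolding pencil_pairs_def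
    by (intro sum.cong card_SigmaI) (use finite_lines finite_line_orbit in auto)
  also have "\<dots> = (\<Sum>m\<in>lines. \<Sum>q\<in>{q \<in> points. q \<in> m}. ?c q m)"
    by (rule sum.swap_restrict[OF finite_points finite_lines])
  also have "\<dots> = (\<Sum>m\<in>lines. card (line_orbit l) - 1)"
  proof (rule sum.cong)
    fix m assume m: "m \<in> lines"
    have "{q \<in> points. q \<in> m} = m" using line_point[OF m] by auto
    moreover have "(\<Sum>q\<in>m. ?c q m) = card (line_orbit m - {m})"
      by (rule sum_card_meeting_lines[OF m]) (use line_orbit_subset[OF m] in auto)
    ultimately show "(\<Sum>q\<in>{q \<in> points. q \<in> m}. ?c q m) = card (line_orbit l) - 1"
      using self_in_line_orbit[OF m] finite_line_orbit[OF m] card_line_orbit_eq[OF l m] by simp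
  qed simp
  finally have "card points * card (pencil_pairs p) = card points * (card (line_orbit l) - 1)"
    by (simp add: card_lines card_points)
  then show ?thesis unfolding mult_cancel1 by (simp add: card_points)
qed

section \<open>Point stabilizers in the normal subgroup\<close>

definition "point_stabilizer p = {g \<in> N. g p = p}"

lemma stabilizer_collineation_group:
  assumes p: "p \<in> points"
  shows "collineation_group points lines x (point_stabilizer p)"
proof (intro collineation_group.intro collineation_group_axioms.intro finite_projective_plane_axioms)
  have "subgroup (point_stabilizer p) N.\<K>"
    using N.points_action.stabilizer_subgroup[OF p]
    by (simp add: stabilizer_def point_stabilizer_def)
  then show "subgroup (point_stabilizer p) (CollineationGroup points lines)"
    using group.incl_subgroup[OF group_CollineationGroup subgroup_N] by blast
qed

lemma card_stabilizer_prime_power: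
  assumes r: "Factorial_Ring.prime (r::nat)" "card N = r ^ k" and p: "p \<in> points"
  shows "\<exists>j. card (point_stabilizer p) = r ^ j"
proof -
  have "card (point_stabilizer p) dvd card N"
    using dvd_triv_right[of "card (stabilizer N.\<K> (\<lambda>g. g) p)" "card (orbit N.\<K> (\<lambda>g. g) p)"]
    unfolding N.points_action.orbit_stabilizer_theorem[OF p]
    by (simp add: order_def stabilizer_def point_stabilizer_def)
  then show ?thesis unfolding r(2) using divides_primepow_nat[OF r(1)] by blast
qed

text \<open>A line through \<open>p\<close> moved by the stabilizer has at least \<open>r\<close>
  images under it, all through \<open>p\<close> and in one \<open>N\<close>-orbit. It is thus the
  first entry of at least \<open>r - 1\<close> pairs in \<open>pencil_pairs p\<close>.\<close>

lemma moved_lines_bound: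
  assumes r: "Factorial_Ring.prime (r::nat)" "card N = r ^ k" and p: "p \<in> points"
    and l: "l \<in> lines"
  shows "(x + 1 - card {l \<in> collineation_group.fixed_lines lines (point_stabilizer p). p \<in> l}) * (r - 1)
    \<le> card (line_orbit l) - 1"
proof -
  interpret H: collineation_group points lines x "point_stabilizer p"
    by (rule stabilizer_collineation_group[OF p])
  obtain j where j: "card (point_stabilizer p) = r ^ j"
    using card_stabilizer_prime_power[OF r p] by blast
  have pfix: "p \<in> H.fixed_points" using p unfolding H.fixed_points_def by (simp add: point_stabilizer_def)
  let ?L = "{l \<in> lines. p \<in> l}" and ?F = "{l \<in> H.fixed_lines. p \<in> l}"
  interpret A: group_action H.\<K> ?L "\<lambda>g. \<lambda>l\<in>?L. g ` l" by (rule H.pencil_action[OF pfix])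
  have moved: "r - 1 \<le> card {m \<in> line_orbit l - {l}. p \<in> m}" if l: "l \<in> ?L - ?F" for l
  proof -
    let ?O = "orbit H.\<K> (\<lambda>g. \<lambda>l\<in>?L. g ` l) l"
    have lL: "l \<in> ?L" "l \<in> lines" using l by auto
    obtain g where g: "g \<in> point_stabilizer p" "g ` l \<noteq> l" using l by (auto simp: H.fixed_lines_def)
    have "order H.\<K> = r ^ j" using j by (simp add: order_def)
    then have dvd: "r dvd card ?O" using A.prime_dvd_card_orbit[OF r(1) _ lL(1), of j g] g lL by simp
    have "?O \<subseteq> {m \<in> line_orbit l. p \<in> m}"
    proof
      fix m assume m: "m \<in> ?O"
      then obtain h where h: "h \<in> point_stabilizer p" "m = h ` l" using lL by (auto simp: orbit_def)
      then have "m \<in> line_orbit l" by (auto simp: line_orbit_def point_stabilizer_def)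
      moreover have "h p \<in> m" using h lL by blast
      ultimately show "m \<in> {m \<in> line_orbit l. p \<in> m}" using h by (simp add: point_stabilizer_def)
    qed
    then have "card ?O \<le> card {m \<in> line_orbit l. p \<in> m}"
      using finite_line_orbit[OF lL(2)] by (intro card_mono) auto
    moreover have "l \<in> ?O" by (rule A.orbit_refl[OF lL(1)])
    then have "r \<le> card ?O" using dvd \<open>?O \<subseteq> _\<close> finite_line_orbit[OF lL(2)]
      by (intro dvd_imp_le) (auto simp: card_gt_0_iff intro: finite_subset)
    moreover have "{m \<in> line_orbit l - {l}. p \<in> m} = {m \<in> line_orbit l. p \<in> m} - {l}" by auto
    moreover have "l \<in> {m \<in> line_orbit l. p \<in> m}" using self_in_line_orbit lL by simp
    ultimately show ?thesis by simp
  qed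
  \<comment> \<open>By this inclusion the truncated difference is the true number of moved
    lines.\<close>
  have "?F \<subseteq> ?L" by (auto simp: H.fixed_lines_def)
  then have "(x + 1 - card ?F) * (r - 1) = card (?L - ?F) * (r - 1)"
    using card_lines_through[OF p] finite_lines by (simp add: card_Diff_subset finite_subset)
  also have "\<dots> \<le> (\<Sum>l\<in>?L - ?F. card {m \<in> line_orbit l - {l}. p \<in> m})"
    using sum_bounded_below[of "?L - ?F", OF moved] by simp
  also have "\<dots> \<le> (\<Sum>l\<in>?L. card {m \<in> line_orbit l - {l}. p \<in> m})"
    using finite_lines by (intro sum_mono2) auto
  also have "\<dots> = card (pencil_pairs p)"
    unfolding pencil_pairs_def
    by (rule card_SigmaI[symmetric]) (use finite_lines finite_line_orbit in auto)
  finally show ?thesis using card_pencil_pairs[OF p l] by simp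
qed

theorem prime_power_semiregular:
  assumes r: "Factorial_Ring.prime (r::nat)" "card N = r ^ k" and u: "x = u ^ 2"
    and p: "p \<in> points" and g: "g \<in> N" "g p = p"
  shows "g = \<one>\<^bsub>\<K>\<^esub>"
proof (rule ccontr)
  assume g1: "g \<noteq> \<one>\<^bsub>\<K>\<^esub>"
  obtain l where l: "l \<in> lines" by (rule line_avoiding)
  let ?t = "card (line_orbit l)"
  have "order N.\<K> = r ^ k" using r(2) by (simp add: order_def)
  then obtain j where j: "?t = r ^ j"
    using group_action.card_orbit_prime_power[OF N.lines_action r(1) _ l] line_orbit_eq[OF l] by metis
  have t: "r ^ j dvd x ^ 2 + x + 1" using card_line_orbit_dvd[OF l] j by simp
  \<comment> \<open>If all line orbits were singletons, \<open>g\<close> would fix every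
    line.\<close>
  have "j \<noteq> 0"
  proof
    assume "j = 0"
    then have 1: "card (line_orbit m) = 1" if "m \<in> lines" for m
      using card_line_orbit_eq[OF l that] j by simp
    have "g ` m = m" if m: "m \<in> lines" for m
    proof -
      have "g ` m \<in> line_orbit m" using g by (auto simp: line_orbit_def)
      then show ?thesis using 1[OF m] self_in_line_orbit[OF m] by (metis card_1_singletonE singletonD)
    qed
    then have "g = \<one>\<^bsub>N.\<K>\<^esub>" by (rule N.eq_one_if_lines_fixed[OF g(1)])
    then show False using g1 by simp
  qed
  then have rv: "r dvd x ^ 2 + x + 1" using t by (meson dvd_power dvd_trans gr0I)
  have "odd (x ^ 2 + x + 1)" by simp
  then have r2: "r \<noteq> 2" using rv by auto
  have H: "collineation_group points lines x (point_stabilizer q)" if "q \<in> points" for q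
    by (rule stabilizer_collineation_group[OF that])
  interpret H: collineation_group points lines x "point_stabilizer p" by (rule H[OF p])
  have gH: "g \<in> point_stabilizer p" using g by (simp add: point_stabilizer_def)
  have pfix: "p \<in> H.fixed_points" using p unfolding H.fixed_points_def by (simp add: point_stabilizer_def)
  obtain i where i: "card (point_stabilizer p) = r ^ i"
    using card_stabilizer_prime_power[OF r p] by blast
  show False
  proof (cases "r = 3")
    case True
    have "j < 2"
    proof (rule ccontr)
      assume "\<not> j < 2"
      then have "(3::nat) ^ 2 dvd 3 ^ j" by (intro le_imp_power_dvd) simp
      then show False using t nine_not_dvd[of x] unfolding True by (auto dest: dvd_trans)
    qed
    then have "j = 1" using \<open>j \<noteq> 0\<close> by linarith
    then have t3: "?t = 3" using j True by simp
    \<comment> \<open>With \<open>r = 3\<close> and orbit size \<open>3\<close>, at most one line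
      through \<open>q\<close> is moved, and the congruence modulo \<open>3\<close> excludes exactly
      one.\<close>
    have centre: "h ` m = m"
      if q: "q \<in> points" and m: "m \<in> lines" "q \<in> m" and h: "h \<in> point_stabilizer q" for q m h
    proof -
      interpret Q: collineation_group points lines x "point_stabilizer q" by (rule H[OF q])
      obtain i where i: "card (point_stabilizer q) = r ^ i"
        using card_stabilizer_prime_power[OF r q] by blast
      have qfix: "q \<in> Q.fixed_points" using q unfolding Q.fixed_points_def by (simp add: point_stabilizer_def)
      let ?F = "{l \<in> Q.fixed_lines. q \<in> l}"
      have sub: "?F \<subseteq> {l \<in> lines. q \<in> l}" by (auto simp: Q.fixed_lines_def)
      have "card ?F mod 3 = (x + 1) mod 3"
        using Q.card_fixed_lines_through_mod[OF r(1) i qfix] True by simp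
      moreover have "(x + 1 - card ?F) * 2 \<le> 2"
        using moved_lines_bound[OF r q l] t3 True by simp
      moreover have "card ?F \<le> x + 1"
        using card_mono[OF _ sub] finite_lines card_lines_through[OF q] by simp
      moreover have "c = x + 1" if "c mod 3 = (x + 1) mod 3" "(x + 1 - c) * 2 \<le> 2" "c \<le> x + 1" for c
      proof (rule ccontr)
        assume "c \<noteq> x + 1"
        then have "c = x" using that(2,3) by linarith
        then show False using that(1) by presburger
      qed
      ultimately have "card ?F = x + 1" by blast
      then have "?F = {l \<in> lines. q \<in> l}"
        using card_subset_eq[OF _ sub] finite_lines card_lines_through[OF q] by simp
      then have "m \<in> ?F" using m by blast
      then show ?thesis using h by (simp add: Q.fixed_lines_def)
    qed
    \<comment> \<open>The number of fixed points is divisible by \<open>3\<close>, like the number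
      of all points.\<close>
    have "\<exists>q. q \<in> H.fixed_points \<and> q \<noteq> p"
    proof (rule ccontr)
      assume "\<not> ?thesis"
      then have "H.fixed_points = {p}" using pfix by blast
      then have "1 mod 3 = card points mod 3" using H.card_fixed_points_mod[OF r(1) i] True by simp
      moreover have "card points mod 3 = 0"
        using rv unfolding True card_points[symmetric] by (rule dvd_imp_mod_0)
      ultimately show False by simp
    qed
    then obtain q where q: "q \<in> H.fixed_points" "q \<noteq> p" by blast
    have qp: "q \<in> points" using q by (simp add: H.fixed_points_def)
    have "g q = q" using q gH by (simp add: H.fixed_points_def)
    then have gq: "g \<in> point_stabilizer q" using g by (simp add: point_stabilizer_def)
    have "g = \<one>\<^bsub>H.\<K>\<^esub>"
      by (rule H.eq_one_if_two_centres[OF gH p centre[OF p _ _ gH] qp centre[OF qp _ _ gq]])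
        (use q in auto)
    then show False using g1 by simp
  next
    case False
    have "r \<noteq> 4" using r(1) by auto
    moreover have "2 \<le> r" using prime_ge_2_nat[OF r(1)] .
    ultimately have r5: "5 \<le> r" using False r2 by linarith
    let ?F = "{l \<in> H.fixed_lines. p \<in> l}"
    have three: "3 \<le> card (m \<inter> H.fixed_points)" if "m \<in> H.fixed_lines" for m
      using three_le_if_cong_order_plus_1[OF r5 rv H.card_fixed_points_on_line_mod[OF r(1) i that]] .
    have F3: "3 \<le> card ?F"
      using three_le_if_cong_order_plus_1[OF r5 rv H.card_fixed_lines_through_mod[OF r(1) i pfix]] .
    have "point_stabilizer p \<noteq> {\<one>\<^bsub>H.\<K>\<^esub>}" using gH g1 by auto
    then have few: "2 * (card ?F - 1) \<le> x"
      using H.few_fixed_lines_through[OF _ pfix three] F3 by simp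
    \<comment> \<open>At least \<open>x / 2\<close> lines through \<open>p\<close> are moved, each
      accounting for at least \<open>4\<close> pairs, so the orbit size exceeds
      \<open>2 * x\<close>.\<close>
    have "(x + 1 - card ?F) * 4 \<le> (x + 1 - card ?F) * (r - 1)"
      using r5 by (intro mult_le_mono2) simp
    also have "\<dots> \<le> r ^ j - 1" using moved_lines_bound[OF r p l] j by simp
    finally have "2 * x \<le> r ^ j - 1" using few F3 by simp
    moreover have "0 < u" using u order_ge_2 by (cases u) auto
    then have "r ^ j \<le> u ^ 2 + u + 1"
      using prime_power_le_of_square_order[OF r(1), of u j] t u by simp
    \<comment> \<open>The two bounds on \<open>r ^ j\<close> combine to
      \<open>2 * u^2 \<le> u^2 + u\<close>.\<close>
    ultimately have "u ^ 2 \<le> u" using u by simp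
    moreover have "2 \<le> u" using u order_ge_2 \<open>0 < u\<close> by (cases "u = 1") auto
    ultimately show False using \<open>0 < u\<close> by (simp add: power2_eq_square)
  qed
qed

end

section \<open>Nilpotent normal subgroups\<close>

text \<open>Membership in \<open>P\<close> is decided within \<open>F\<close> by a condition on
  powers, which conjugation preserves.\<close>

lemma (in group) primary_subgroup_normal:
  assumes F: "F \<lhd> G" and P: "subgroup P (G\<lparr>carrier := F\<rparr>)"
    and prim: "\<And>a. a \<in> F \<Longrightarrow> a \<in> P \<longleftrightarrow> (\<exists>j. a [^] ((r::nat) ^ j) = \<one>)"
  shows "P \<lhd> G"
proof (rule normal_invI)
  have FG: "subgroup F G" by (rule normal_imp_subgroup[OF F])
  show "subgroup P G" by (rule incl_subgroup[OF FG P])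
  fix g a assume g: "g \<in> carrier G" and a: "a \<in> P"
  have aF: "a \<in> F" using subgroup.subset[OF P] a by auto
  have aG: "a \<in> carrier G" using subgroup.mem_carrier[OF FG aF] .
  obtain j where "a [^] (r ^ j) = \<one>" using prim[OF aF] a by blast
  then have "(g \<otimes> a \<otimes> inv g) [^] (r ^ j) = \<one>" using conj_nat_pow[OF g aG] g by simp
  moreover have "g \<otimes> a \<otimes> inv g \<in> F" by (rule normal.inv_op_closed2[OF F g aF])
  ultimately show "g \<otimes> a \<otimes> inv g \<in> P" using prim by blast
qed

lemma (in collineation_group) finite_K: "finite K"
proof (rule finite_subset)
  show "K \<subseteq> points \<rightarrow>\<^sub>E points"
    using points_action.bij_prop0 by (auto simp: Bij_def bij_betw_def PiE_def)
  show "finite (points \<rightarrow>\<^sub>E points)" by (rule finite_PiE) (use finite_points in auto)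
qed

theorem theoremA:
  fixes points :: "'p set" and lines :: "'p set set"
    and x u :: nat and G F :: "('p \<Rightarrow> 'p) set"
  assumes "finite_projective_plane points lines x"
    and "\<not> desarguesian lines"
    and "u > 0" and "x = u ^ 2"
    and "subgroup G (CollineationGroup points lines)"
    and "transitive_action (CollineationGroup points lines \<lparr>carrier := G\<rparr>) points (\<lambda>g. g)"
    and "F \<lhd> (CollineationGroup points lines \<lparr>carrier := G\<rparr>)"
    and "nilpotent (CollineationGroup points lines \<lparr>carrier := F\<rparr>)"
  shows "semiregular_action (CollineationGroup points lines \<lparr>carrier := F\<rparr>) points (\<lambda>g. g)"
proof -
  interpret finite_projective_plane points lines x by (rule assms(1))
  have "collineation_group points lines x G"
    by (intro collineation_group.intro collineation_group_axioms.intro assms(1,5))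
  moreover have "transitive_collineation_group_axioms points G"
    using transitive_action.unique_orbit[OF assms(6)]
    by (auto simp: transitive_collineation_group_axioms_def)
  ultimately have trans: "transitive_collineation_group points lines x G"
    by (rule transitive_collineation_group.intro)
  interpret G: transitive_collineation_group points lines x G by (rule trans)
  have FG: "subgroup F G.\<K>" by (rule normal_imp_subgroup[OF assms(7)])
  interpret F: collineation_group points lines x F
    using group.incl_subgroup[OF group_CollineationGroup assms(5) FG]
    by (intro collineation_group.intro collineation_group_axioms.intro assms(1))
  have "f = \<one>\<^bsub>F.\<K>\<^esub>" if f: "f \<in> F" and p: "p \<in> points" and fp: "f p = p" for f p
  proof (rule ccontr)
    assume f1: "f \<noteq> \<one>\<^bsub>F.\<K>\<^esub>"
    have fc: "f \<in> carrier F.\<K>" using f by simp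
    have "F.ord f \<noteq> 1" using F.ord_eq_1[OF fc] f1 by blast
    then obtain r where r: "Factorial_Ring.prime r" "r dvd F.ord f" using prime_factor_nat by blast
    \<comment> \<open>The power of \<open>f\<close> of prime order \<open>r\<close>; it still fixes
      \<open>p\<close>.\<close>
    define h where "h = f [^]\<^bsub>F.\<K>\<^esub> (F.ord f div r)"
    have pow_fix: "(f [^]\<^bsub>F.\<K>\<^esub> n) p = p \<and> f [^]\<^bsub>F.\<K>\<^esub> n \<in> F" for n :: nat
    proof (induction n)
      case (Suc n)
      then show ?case using F.mult_apply[of "f [^]\<^bsub>F.\<K>\<^esub> n" f p] F.m_closed[of "f [^]\<^bsub>F.\<K>\<^esub> n" f] f p fp
        by simp
    qed (use F.one_apply[OF p] F.one_closed in simp)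
    have h: "h \<in> F" "h p = p" using pow_fix by (simp_all add: h_def)
    have "h [^]\<^bsub>F.\<K>\<^esub> r = f [^]\<^bsub>F.\<K>\<^esub> F.ord f"
      unfolding h_def F.nat_pow_pow[OF fc] using r(2) by simp
    then have hr: "h [^]\<^bsub>F.\<K>\<^esub> (r ^ 1) = \<one>\<^bsub>F.\<K>\<^esub>" using F.pow_ord_eq_1[OF fc] by simp
    have h1: "h \<noteq> \<one>\<^bsub>F.\<K>\<^esub>"
    proof
      assume "h = \<one>\<^bsub>F.\<K>\<^esub>"
      then have "F.ord f dvd F.ord f div r" unfolding h_def using F.pow_eq_id[OF fc] by simp
      moreover have "0 < F.ord f" using F.ord_ge_1[OF _ fc] F.finite_K by simp
      ultimately have "F.ord f \<le> F.ord f div r" using r(2) prime_gt_0_nat[OF r(1)]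
        by (intro dvd_imp_le) (auto simp: dvd_div_eq_0_iff)
      moreover have "F.ord f div r < F.ord f"
        using prime_gt_1_nat[OF r(1)] \<open>0 < F.ord f\<close> by (rule div_less_dividend)
      ultimately show False by simp
    qed
    obtain P k where P: "subgroup P F.\<K>" "card P = r ^ k"
      and prim: "\<And>a. a \<in> F \<Longrightarrow> a \<in> P \<longleftrightarrow> (\<exists>j. a [^]\<^bsub>F.\<K>\<^esub> (r ^ j) = \<one>\<^bsub>F.\<K>\<^esub>)"
      using F.nilpotent_primary_subgroup[OF assms(8) _ r(1)] F.finite_K by auto
    have "P \<lhd> G.\<K>"
    proof (rule G.primary_subgroup_normal[OF assms(7)])
      show "subgroup P (G.\<K>\<lparr>carrier := F\<rparr>)" using P(1) by simp
      \<comment> \<open>Powers do not depend on the carrier, so the criterion transfers from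
        \<open>F\<close> to \<open>G\<close>.\<close>
      show "a \<in> P \<longleftrightarrow> (\<exists>j. a [^]\<^bsub>G.\<K>\<^esub> (r ^ j) = \<one>\<^bsub>G.\<K>\<^esub>)" if "a \<in> F" for a
        using prim[OF that] by (simp add: nat_pow_def)
    qed
    then interpret N: transitive_normal points lines x G P
      by (intro transitive_normal.intro transitive_normal_axioms.intro trans)
    have hP: "h \<in> P" using prim[OF h(1)] hr by blast
    have "h = \<one>\<^bsub>G.\<K>\<^esub>"
      by (rule N.prime_power_semiregular[OF r(1) P(2) assms(4) p hP h(2)])
    then show False using h1 by simp
  qed
  then show ?thesis
    using F.points_action.group_action_axioms
    by (auto simp: semiregular_action_def semiregular_action_axioms_def)
qed

end
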